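(* The integral transform $$B[f](z):=\int_0^{+\infty}K(z,x)f(x)\,dx,\qquad f\in L^2(\mathbb{R}_+,e^{-x}dx),\ z\in\mathbb{D},$$ where $$K(z,x)=\frac{1}{\sqrt{\pi}}\left[1+\frac{z}{\Gamma(\frac32)}\int_0^{+\infty}\sqrt{t}\,e^{-t}(1-ze^{-t})^{-2}\exp\!\left(\frac{-xze^{-t}}{1-ze^{-t}}\right)L_1\!\left(\frac{x}{1-ze^{-t}}\right)dt\right],$$ is a Bargmann transform associated with the classical Dirichlet space $\mathcal{D}$, that is, a unitary isomorphism from $L^2(\mathbb{R}_+,e^{-x}dx)$ to $\mathcal{D}$.
   Context: $\mathbb{D}$ is the open unit disk in $\mathbb{C}$, $d\lambda$ is Lebesgue area measure on $\mathbb{D}$, $\mathbb{R}_+=[0,+\infty)$, $\Gamma$ is the Euler Gamma function, and $L_1(x)=1-x$ is the Laguerre polynomial of degree one (with parameter $0$). The classical Dirichlet space $\mathcal{D}$ is the space of holomorphic functions $f$ on $\mathbb{D}$ for which the Dirichlet integral $\frac1\pi\int_{\mathbb{D}}|f'(z)|^2\,d\lambda(z)$ is finite, equipped with the scalar product $$\langle f,g\rangle_{\mathcal{D}}=f(0)\overline{g(0)}+\int_{\mathbb{D}}f'(z)\overline{g'(z)}\,d\lambda(z),$$ so that the square of the norm of $f$ is $|f(0)|^2+\int_{\mathbb{D}}|f'(z)|^2\,d\lambda(z)$.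
   Formalization: The transform integrates against e^{-x}dx instead of dx (which diverges for f=1, z=0). As B[1]=1/√π has norm ≠1, unitarity is shown for K with f(0)conj g(0) weighted by π in the scalar product, and for the stated scalar product with the constant term of K equal to 1 instead of 1/√π. *)

theory Defs
  imports "HOL-Analysis.Analysis" "HOL-Complex_Analysis.Complex_Analysis"
begin

definition laguerre_measure :: "real measure" where
  "laguerre_measure = density lborel (\<lambda>x. ennreal (indicator {0..} x * exp (- x)))"

text \<open>Elements of \<open>L\<^sup>2(\<real>\<^sub>+, e\<^sup>-\<^sup>xdx)\<close> are represented by functions;
  two functions represent the same element iff they are related by \<open>laguerre_eq\<close>.\<close>

definition laguerre_L2 :: "(real \<Rightarrow> complex) set" where
  "laguerre_L2 = {f \<in> borel_measurable laguerre_measure.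
     integrable laguerre_measure (\<lambda>x. (cmod (f x))\<^sup>2)}"

definition laguerre_eq :: "(real \<Rightarrow> complex) \<Rightarrow> (real \<Rightarrow> complex) \<Rightarrow> bool" where
  "laguerre_eq f g \<longleftrightarrow> (AE x in laguerre_measure. f x = g x)"

definition laguerre_inner :: "(real \<Rightarrow> complex) \<Rightarrow> (real \<Rightarrow> complex) \<Rightarrow> complex" where
  "laguerre_inner f g = (LINT x|laguerre_measure. f x * cnj (g x))"

text \<open>Functions on the disk are represented by total functions; their values outside the disk
  are irrelevant, so equality of elements of the Dirichlet space is \<open>disk_eq\<close>.\<close>

abbreviation unit_disk :: "complex set" where
  "unit_disk \<equiv> ball 0 1"

definition dirichlet_space :: "(complex \<Rightarrow> complex) set" where
  "dirichlet_space = {f. f holomorphic_on unit_disk \<and>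
     set_integrable lborel unit_disk (\<lambda>z. (cmod (deriv f z))\<^sup>2)}"

definition disk_eq :: "(complex \<Rightarrow> complex) \<Rightarrow> (complex \<Rightarrow> complex) \<Rightarrow> bool" where
  "disk_eq f g \<longleftrightarrow> (\<forall>z\<in>unit_disk. f z = g z)"

definition dirichlet_inner :: "(complex \<Rightarrow> complex) \<Rightarrow> (complex \<Rightarrow> complex) \<Rightarrow> complex" where
  "dirichlet_inner f g =
     f 0 * cnj (g 0) + (LINT z:unit_disk|lborel. deriv f z * cnj (deriv g z))"

text \<open>The same with the constants carrying their area norm \<open>\<integral>\<^bsub>\<bbbD>\<^esub> \<bar>f(0)\<bar>\<^sup>2 d\<lambda> = \<pi> \<bar>f(0)\<bar>\<^sup>2\<close>,
  that is, \<open>\<pi>\<close> times the scalar product formed with the normalized area measure \<open>d\<lambda>/\<pi>\<close>.\<close>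

definition dirichlet_inner_area ::
    "(complex \<Rightarrow> complex) \<Rightarrow> (complex \<Rightarrow> complex) \<Rightarrow> complex" where
  "dirichlet_inner_area f g =
     of_real pi * (f 0 * cnj (g 0)) + (LINT z:unit_disk|lborel. deriv f z * cnj (deriv g z))"

definition laguerre_1 :: "complex \<Rightarrow> complex" where
  "laguerre_1 x = 1 - x"

definition kernel_integrand :: "complex \<Rightarrow> real \<Rightarrow> real \<Rightarrow> complex" where
  "kernel_integrand z x t =
     of_real (sqrt t) * of_real (exp (- t)) * (1 - z * of_real (exp (- t))) powi (-2)
     * exp (- of_real x * z * of_real (exp (- t)) / (1 - z * of_real (exp (- t))))
     * laguerre_1 (of_real x / (1 - z * of_real (exp (- t))))"

definition kernel_part :: "complex \<Rightarrow> real \<Rightarrow> complex" where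
  "kernel_part z x = z / of_real (Gamma (3 / 2)) * (LINT t:{0..}|lborel. kernel_integrand z x t)"

definition bargmann_kernel :: "complex \<Rightarrow> real \<Rightarrow> complex" where
  "bargmann_kernel z x = 1 / of_real (sqrt pi) * (1 + kernel_part z x)"

text \<open>In \<open>dirichlet_inner\<close> the constant \<open>1\<close> is a unit vector, while \<open>z\<^sup>n\<close> has norm
  \<open>sqrt (\<pi> n)\<close> for \<open>n \<ge> 1\<close>: the factor \<open>1 / sqrt \<pi>\<close> then belongs to the
  nonconstant part of the kernel only.  In \<open>dirichlet_inner_area\<close> the constant \<open>1\<close> has norm
  \<open>sqrt \<pi>\<close>, which is what \<open>bargmann_kernel\<close> requires.\<close>

definition bargmann_kernel_unit :: "complex \<Rightarrow> real \<Rightarrow> complex" where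
  "bargmann_kernel_unit z x = 1 + 1 / of_real (sqrt pi) * kernel_part z x"

text \<open>The integration is with respect to \<open>e\<^sup>-\<^sup>xdx\<close>: at \<open>z = 0\<close> the kernel is a nonzero
  constant, and constants are not integrable against \<open>dx\<close> on the half-line.\<close>

definition bargmann_transform ::
    "(complex \<Rightarrow> real \<Rightarrow> complex) \<Rightarrow> (real \<Rightarrow> complex) \<Rightarrow> complex \<Rightarrow> complex" where
  "bargmann_transform K f z = (LINT x|laguerre_measure. K z x * f x)"

text \<open>A unitary isomorphism between inner product spaces \<open>V/eqV\<close> and \<open>W/eqW\<close> of (classes of)
  functions: a well-defined, linear, bijective map preserving the scalar product.\<close>

definition unitary_isomorphism ::
    "('a \<Rightarrow> complex) set \<Rightarrow> (('a \<Rightarrow> complex) \<Rightarrow> ('a \<Rightarrow> complex) \<Rightarrow> bool)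
       \<Rightarrow> (('a \<Rightarrow> complex) \<Rightarrow> ('a \<Rightarrow> complex) \<Rightarrow> complex)
     \<Rightarrow> ('b \<Rightarrow> complex) set \<Rightarrow> (('b \<Rightarrow> complex) \<Rightarrow> ('b \<Rightarrow> complex) \<Rightarrow> bool)
       \<Rightarrow> (('b \<Rightarrow> complex) \<Rightarrow> ('b \<Rightarrow> complex) \<Rightarrow> complex)
     \<Rightarrow> (('a \<Rightarrow> complex) \<Rightarrow> 'b \<Rightarrow> complex) \<Rightarrow> bool" where
  "unitary_isomorphism V eqV ipV W eqW ipW T \<longleftrightarrow>
     (\<forall>f\<in>V. T f \<in> W) \<and>
     (\<forall>f\<in>V. \<forall>g\<in>V. eqV f g \<longleftrightarrow> eqW (T f) (T g)) \<and>
     (\<forall>g\<in>W. \<exists>f\<in>V. eqW (T f) g) \<and>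
     (\<forall>a b. \<forall>f\<in>V. \<forall>g\<in>V. eqW (T (\<lambda>x. a * f x + b * g x)) (\<lambda>z. a * T f z + b * T g z)) \<and>
     (\<forall>f\<in>V. \<forall>g\<in>V. ipW (T f) (T g) = ipV f g)"

end

theory Submission
  imports Defs "HOL-Probability.Distributions" "HOL-Real_Asymp.Real_Asymp"
begin

text \<open>Expanding the kernel with the derivative of the generating function of the Laguerre polynomials
  \<open>L\<^sub>n\<close> and \<open>\<integral>sqrt t exp (- n t) dt = \<Gamma>(3/2) / (n sqrt n)\<close> gives
  \<open>K(z, x) = (1 + \<Sum>n\<ge>1. z\<^sup>n L\<^sub>n(x) / sqrt n) / sqrt \<pi>\<close>.  The \<open>L\<^sub>n\<close> form an orthonormal
  basis of \<open>L\<^sup>2(\<real>\<^sub>+, e\<^sup>-\<^sup>xdx)\<close>, and the monomials \<open>z\<^sup>n\<close> are orthogonal in the Dirichlet space with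
  square norm \<open>\<pi> n\<close> for \<open>n \<ge> 1\<close>; so the transform carries one orthonormal basis to another.
  Completeness of the \<open>L\<^sub>n\<close> follows from the generating function: a function orthogonal to
  all \<open>L\<^sub>n\<close> is orthogonal to every \<open>exp (- k x)\<close>, hence vanishes by Weierstrass approximation in
  the variable \<open>exp (- x)\<close>.  Orthogonality of the monomials follows from the rotation invariance
  of the area measure.\<close>

section \<open>Area integrals over the disk\<close>

text \<open>The unitary property is reduced to norms. Area integrals of squared moduli are evaluated
  in \<open>ennreal\<close>, where no finiteness has to be known beforehand: one identity then both
  decides membership in \<open>dirichlet_space\<close> and gives the Dirichlet integral, and scalar
  products are recovered by polarization. The obstacle on the area side is the boundary: a power
  series on the disk need not be bounded there, so the integrals are taken over radii r < 1 first
  and then pass to the limit by monotone convergence. Polar coordinates are replaced by two facts: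
  rotations preserve area, and the area of a disk is linear in the square of its radius. On the
  Laguerre side, completeness alone does not give a map onto the Dirichlet space; every square
  summable sequence must also occur as a coefficient sequence. This Riesz-Fischer statement gives
  surjectivity, and together with completeness it gives Parseval's identity.\<close>

text \<open>\<open>lborel\<close> is determined by its values on boxes, and a box in the plane is a
  product of intervals in the real and imaginary parts. This is what makes iterated integration over
  the plane available.\<close>

lemma lborel_complex_eq_distr_pair:
  "(lborel :: complex measure) = distr (lborel \<Otimes>\<^sub>M lborel) borel (\<lambda>(x, y). Complex x y)"
proof (rule lborel_eqI)
  fix l u :: complex
  assume le: "\<And>b. b \<in> Basis \<Longrightarrow> l \<bullet> b \<le> u \<bullet> b"
  then have le': "Re l \<le> Re u" "Im l \<le> Im u"
    using le[of 1] le[of \<i>] by (auto simp: Basis_complex_def)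
  have [measurable]: "(\<lambda>(x, y). Complex x y) \<in> borel_measurable (lborel \<Otimes>\<^sub>M lborel)"
    unfolding case_prod_beta Complex_eq by measurable
  have "(\<lambda>(x, y). Complex x y) -` box l u = {Re l<..<Re u} \<times> {Im l<..<Im u}"
    by (auto simp: box_def Basis_complex_def inner_complex_def)
  then show "emeasure (distr (lborel \<Otimes>\<^sub>M lborel) borel (\<lambda>(x, y). Complex x y)) (box l u)
      = (\<Prod>b\<in>Basis. (u - l) \<bullet> b)"
    using le' by (simp add: emeasure_distr lborel.emeasure_pair_measure_Times space_pair_measure
        Basis_complex_def inner_complex_def ennreal_mult)
qed simp

lemma borel_measurable_Complex_pair [measurable]:
  assumes [measurable]: "f \<in> borel_measurable borel"
  shows "(\<lambda>(x, y). f (Complex x y)) \<in> borel_measurable (lborel \<Otimes>\<^sub>M lborel)"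
  unfolding case_prod_beta Complex_eq by measurable

text \<open>Both orders of integration are stated: horizontal shears move the real part and vertical
  shears the imaginary part, and each needs its moving variable to be the inner one.\<close>

lemma nn_integral_lborel_complex:
  fixes f :: "complex \<Rightarrow> ennreal"
  assumes [measurable]: "f \<in> borel_measurable borel"
  shows "(\<integral>\<^sup>+z. f z \<partial>lborel) = (\<integral>\<^sup>+y. \<integral>\<^sup>+x. f (Complex x y) \<partial>lborel \<partial>lborel)"
    and "(\<integral>\<^sup>+z. f z \<partial>lborel) = (\<integral>\<^sup>+x. \<integral>\<^sup>+y. f (Complex x y) \<partial>lborel \<partial>lborel)"
proof -
  have [measurable]: "(\<lambda>(x, y). Complex x y) \<in> borel_measurable (lborel \<Otimes>\<^sub>M lborel)"
    unfolding case_prod_beta Complex_eq by measurable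
  have "(\<integral>\<^sup>+z. f z \<partial>lborel) = (\<integral>\<^sup>+p. f (Complex (fst p) (snd p)) \<partial>(lborel \<Otimes>\<^sub>M lborel))"
    by (subst lborel_complex_eq_distr_pair) (simp add: nn_integral_distr case_prod_beta)
  then have *: "(\<integral>\<^sup>+z. f z \<partial>lborel) = (\<integral>\<^sup>+(x, y). f (Complex x y) \<partial>(lborel \<Otimes>\<^sub>M lborel))"
    by (simp add: case_prod_unfold)
  show "(\<integral>\<^sup>+z. f z \<partial>lborel) = (\<integral>\<^sup>+y. \<integral>\<^sup>+x. f (Complex x y) \<partial>lborel \<partial>lborel)"
    unfolding * by (subst lborel_pair.nn_integral_snd[symmetric]) auto
  show "(\<integral>\<^sup>+z. f z \<partial>lborel) = (\<integral>\<^sup>+x. \<integral>\<^sup>+y. f (Complex x y) \<partial>lborel \<partial>lborel)"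
    unfolding * by (subst lborel.nn_integral_fst[symmetric]) auto
qed

text \<open>With one coordinate fixed, a shear only translates the other, which leaves the inner
  integral of the matching iteration unchanged.\<close>

lemma nn_integral_complex_shear:
  fixes f :: "complex \<Rightarrow> ennreal" and k :: real
  assumes [measurable]: "f \<in> borel_measurable borel"
  shows "(\<integral>\<^sup>+z. f (Complex (Re z + k * Im z) (Im z)) \<partial>lborel) = (\<integral>\<^sup>+z. f z \<partial>lborel)"
    and "(\<integral>\<^sup>+z. f (Complex (Re z) (Im z + k * Re z)) \<partial>lborel) = (\<integral>\<^sup>+z. f z \<partial>lborel)"
proof -
  have [measurable]: "(\<lambda>x. f (Complex x y)) \<in> borel_measurable borel"
      "(\<lambda>x. f (Complex y x)) \<in> borel_measurable borel" for y
    unfolding Complex_eq by measurable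
  have 1: "(\<integral>\<^sup>+x. f (Complex (x + k * y) y) \<partial>lborel) = (\<integral>\<^sup>+x. f (Complex x y) \<partial>lborel)" for y
    using nn_integral_real_affine[of "\<lambda>x. f (Complex x y)" 1 "k * y"] by (simp add: add.commute)
  have 2: "(\<integral>\<^sup>+y. f (Complex x (y + k * x)) \<partial>lborel) = (\<integral>\<^sup>+y. f (Complex x y) \<partial>lborel)" for x
    using nn_integral_real_affine[of "\<lambda>y. f (Complex x y)" 1 "k * x"] by (simp add: add.commute)
  have [measurable]: "(\<lambda>z. f (Complex (Re z + k * Im z) (Im z))) \<in> borel_measurable borel"
     "(\<lambda>z. f (Complex (Re z) (Im z + k * Re z))) \<in> borel_measurable borel"
    unfolding Complex_eq by measurable
  show "(\<integral>\<^sup>+z. f (Complex (Re z + k * Im z) (Im z)) \<partial>lborel) = (\<integral>\<^sup>+z. f z \<partial>lborel)"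
    by (simp add: nn_integral_lborel_complex(1) 1)
  show "(\<integral>\<^sup>+z. f (Complex (Re z) (Im z + k * Re z)) \<partial>lborel) = (\<integral>\<^sup>+z. f z \<partial>lborel)"
    by (simp add: nn_integral_lborel_complex(2) 2)
qed

text \<open>A rotation other than \<open>-1\<close> is a product of three shears.\<close>

lemma nn_integral_complex_rotate:
  fixes f :: "complex \<Rightarrow> ennreal"
  assumes [measurable]: "f \<in> borel_measurable borel" and c: "cmod c = 1" "c \<noteq> -1"
  shows "(\<integral>\<^sup>+z. f (c * z) \<partial>lborel) = (\<integral>\<^sup>+z. f z \<partial>lborel)"
proof -
  define a b where "a = Re c" and "b = Im c"
  \<comment> \<open>For c = cis \<theta> this is - tan (\<theta>/2), the slope of the two outer
    shears; the middle one has slope \<open>b\<close>, the sine of \<theta>. The hypothesis c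
    \<noteq> -1 keeps the denominator away from 0.\<close>
  define p where "p = - b / (1 + a)"
  have ab: "a\<^sup>2 + b\<^sup>2 = 1"
    using c(1) by (simp add: cmod_def a_def b_def)
  have a: "1 + a \<noteq> 0"
  proof
    assume "1 + a = 0"
    then have "a = -1" by simp
    with ab have "b = 0" by simp
    with \<open>a = -1\<close> have "c = -1" by (simp add: a_def b_def complex_eq_iff)
    with c(2) show False ..
  qed
  have pb: "1 + p * b = a"
    using a ab by (simp add: p_def field_simps power2_eq_square)
  have "p * (1 + a) = - b"
    using a by (simp add: p_def)
  then have pa: "p * a + p = - b"
    by (simp add: algebra_simps)
  define U where "U z = Complex (Re z + p * Im z) (Im z)" for z
  define L where "L z = Complex (Re z) (Im z + b * Re z)" for z
  have [measurable]: "U \<in> borel_measurable borel" "L \<in> borel_measurable borel"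
    unfolding U_def[abs_def] L_def[abs_def] Complex_eq by measurable
  have "c * z = U (L (U z))" for z
  proof -
    have "Re (U (L (U z))) = (1 + p * b) * Re z + (p * (1 + p * b) + p) * Im z"
      by (simp add: U_def L_def algebra_simps)
    also have "\<dots> = Re (c * z)"
      unfolding pb pa by (simp add: a_def b_def)
    finally have "Re (U (L (U z))) = Re (c * z)" .
    moreover have "Im (U (L (U z))) = b * Re z + (1 + p * b) * Im z"
      by (simp add: U_def L_def algebra_simps)
    then have "Im (U (L (U z))) = Im (c * z)"
      unfolding pb by (simp add: a_def b_def)
    ultimately show ?thesis by (simp add: complex_eq_iff)
  qed
  then have "(\<integral>\<^sup>+z. f (c * z) \<partial>lborel) = (\<integral>\<^sup>+z. f (U (L (U z))) \<partial>lborel)"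
    by simp
  also have "\<dots> = (\<integral>\<^sup>+z. f (U (L z)) \<partial>lborel)"
    unfolding U_def[where z="z::complex" for z]
    using nn_integral_complex_shear(1)[of "\<lambda>z. f (U (L z))" p] by (simp add: U_def)
  also have "\<dots> = (\<integral>\<^sup>+z. f (U z) \<partial>lborel)"
    using nn_integral_complex_shear(2)[of "\<lambda>z. f (U z)" b] by (simp add: L_def)
  also have "\<dots> = (\<integral>\<^sup>+z. f z \<partial>lborel)"
    using nn_integral_complex_shear(1)[of f p] by (simp add: U_def)
  finally show ?thesis .
qed

lemma distr_lborel_complex_rotate:
  assumes "cmod c = 1" "c \<noteq> -1"
  shows "distr lborel borel (\<lambda>z. c * z) = (lborel :: complex measure)"
proof (rule measure_eqI)
  fix A :: "complex set" assume "A \<in> sets (distr lborel borel (\<lambda>z. c * z))"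
  then have [measurable]: "A \<in> sets borel" by simp
  have "emeasure (distr lborel borel (\<lambda>z. c * z)) A = (\<integral>\<^sup>+z. indicator A z \<partial>distr lborel borel (\<lambda>z. c * z))"
    by simp
  also have "\<dots> = (\<integral>\<^sup>+z. indicator A (c * z) \<partial>lborel)"
    by (subst nn_integral_distr) auto
  also have "\<dots> = (\<integral>\<^sup>+z. indicator A z \<partial>lborel)"
    by (rule nn_integral_complex_rotate) (auto simp: assms)
  finally show "emeasure (distr lborel borel (\<lambda>z. c * z)) A = emeasure lborel A" by simp
qed simp

text \<open>Rotation by c preserves the disk and the area but multiplies the integrand by the
  constant \<open>c ^ m * cnj c ^ n\<close>; if this constant is not 1, the integral must
  vanish.\<close>

lemma disk_monomials_orthogonal:
  assumes "m \<noteq> n"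
  shows "(LINT z:ball 0 r|lborel. z ^ m * cnj z ^ n) = (0 :: complex)"
proof -
  define d where "d = \<bar>real m - real n\<bar>"
  \<comment> \<open>The angle is chosen so that \<open>c ^ m * cnj c ^ n\<close> has argument
    \<plusminus>pi/2, hence real part 0 and not 1. As d \<ge> 1, the angle lies strictly between 0
    and pi, so c \<noteq> -1 as the rotation lemma demands.\<close>
  define c where "c = cis (pi / (2 * d))"
  define I where "I = (LINT z:ball 0 r|lborel. z ^ m * cnj z ^ n :: complex)"
  have d: "d \<ge> 1"
    using assms by (auto simp: d_def abs_if)
  have c: "cmod c = 1" by (simp add: c_def)
  have "pi / (2 * d) < pi"
    using d pi_gt_zero by (simp add: field_simps)
  moreover have "0 < pi / (2 * d)"
    using d by simp
  ultimately have "Im c > 0"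
    by (simp add: c_def sin_gt_zero)
  then have "c \<noteq> -1" by auto
  have "c ^ m * cnj c ^ n = cis ((real m - real n) * (pi / (2 * d)))"
    by (simp add: c_def Complex.DeMoivre cis_cnj cis_mult left_diff_distrib diff_divide_distrib)
  then have "Re (c ^ m * cnj c ^ n) = cos ((real m - real n) * (pi / (2 * d)))"
    by simp
  also have "\<dots> = cos \<bar>(real m - real n) * (pi / (2 * d))\<bar>"
    by (rule cos_abs_real[symmetric])
  also have "\<bar>(real m - real n) * (pi / (2 * d))\<bar> = pi / 2"
    using d by (simp add: abs_mult d_def)
  finally have "Re (c ^ m * cnj c ^ n) = 0"
    by simp
  then have ne: "c ^ m * cnj c ^ n \<noteq> 1"
    by (metis one_complex.sel(1) zero_neq_one)
  have [measurable]: "cnj \<in> borel_measurable borel"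
    by (intro borel_measurable_continuous_onI continuous_intros)
  have [measurable]: "ball (0::complex) r \<in> sets borel"
    by simp
  have "I = (\<integral>z. indicator (ball 0 r) z *\<^sub>R (z ^ m * cnj z ^ n) \<partial>distr lborel borel (\<lambda>z. c * z))"
    unfolding distr_lborel_complex_rotate[OF c \<open>c \<noteq> -1\<close>] I_def set_lebesgue_integral_def ..
  also have "\<dots> = (\<integral>z. indicator (ball 0 r) (c * z) *\<^sub>R ((c * z) ^ m * cnj (c * z) ^ n) \<partial>lborel)"
    by (subst integral_distr) auto
  also have "\<dots> = (\<integral>z. (c ^ m * cnj c ^ n) * (indicator (ball 0 r) z *\<^sub>R (z ^ m * cnj z ^ n)) \<partial>lborel)"
    by (intro Bochner_Integration.integral_cong)
      (auto simp: indicator_def norm_mult c power_mult_distrib)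
  also have "\<dots> = (c ^ m * cnj c ^ n) * I"
    unfolding I_def set_lebesgue_integral_def by (rule integral_mult_right_zero)
  finally show ?thesis
    using ne by (simp add: I_def)
qed

section \<open>Norms of monomials and polynomials over a disk\<close>

text \<open>This stands in for polar coordinates: the points with squared modulus at most s have
  area pi s, so the pushforward under the squared modulus has constant density pi.\<close>

lemma distr_disk_cmod_square:
  assumes r: "r > 0"
  shows "distr (density lborel (indicator (ball 0 r))) borel (\<lambda>z::complex. (cmod z)\<^sup>2)
    = density lborel (\<lambda>s. ennreal pi * indicator {0..<r\<^sup>2} s)" (is "?M = ?N")
proof (rule measure_eqI_lessThan)
  have ball: "emeasure lborel (ball (0::complex) \<rho>) = ennreal (pi * \<rho>\<^sup>2)" if "\<rho> \<ge> 0" for \<rho>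
    using that by (simp add: emeasure_ball unit_ball_vol_2)
  have cball: "emeasure lborel (cball (0::complex) \<rho>) = ennreal (pi * \<rho>\<^sup>2)" if "\<rho> \<ge> 0" for \<rho>
    using that by (simp add: emeasure_cball unit_ball_vol_2)
  have [measurable]: "indicator (ball (0::complex) r) \<in> borel_measurable borel"
    by (intro borel_measurable_indicator) auto
  \<comment> \<open>Half-lines suffice to identify the two measures. \<open>max 0 x\<close> accounts
    for half-lines starting left of 0, and \<open>ennreal\<close> cuts the value off at 0 once x
    exceeds \<open>r\<^sup>2\<close>.\<close>
  have *: "emeasure ?M {x<..} = ennreal (pi * (r\<^sup>2 - max 0 x)) \<and> emeasure ?N {x<..} = ennreal (pi * (r\<^sup>2 - max 0 x))" for x
  proof -
    let ?A = "ball 0 r \<inter> {z::complex. x < (cmod z)\<^sup>2}"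
    have A[measurable]: "?A \<in> sets borel" by measurable
    have "emeasure ?M {x<..} = (\<integral>\<^sup>+z. indicator {x<..} ((cmod z)\<^sup>2) * indicator (ball 0 r) z \<partial>lborel)"
      by (subst nn_integral_indicator[symmetric], simp, subst nn_integral_distr, simp, simp,
          subst nn_integral_density) (auto simp: mult.commute)
    also have "\<dots> = (\<integral>\<^sup>+z. indicator ?A z \<partial>lborel)"
      by (intro nn_integral_cong) (auto simp: indicator_def)
    finally have M: "emeasure ?M {x<..} = emeasure lborel ?A"
      by simp
    have "emeasure ?N {x<..} = (\<integral>\<^sup>+s. ennreal pi * (indicator {0..<r\<^sup>2} s * indicator {x<..} s) \<partial>lborel)"
      by (simp add: emeasure_density mult.assoc)
    also have "\<dots> = (\<integral>\<^sup>+s. ennreal pi * indicator ({0..<r\<^sup>2} \<inter> {x<..}) s \<partial>lborel)"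
      by (simp add: indicator_inter_arith)
    finally have N: "emeasure ?N {x<..} = ennreal pi * emeasure lborel ({0..<r\<^sup>2} \<inter> {x<..})"
      by (simp add: nn_integral_cmult_indicator)
    consider "x < 0" | "0 \<le> x" "x < r\<^sup>2" | "r\<^sup>2 \<le> x" by linarith
    then show ?thesis
    proof cases
      case 1
      have "x < (cmod z)\<^sup>2" for z using 1 by (meson less_le_trans zero_le_power2)
      then have "?A = ball 0 r" by auto
      moreover have "{0..<r\<^sup>2} \<inter> {x<..} = {0..<r\<^sup>2}" using 1 by auto
      ultimately show ?thesis unfolding M N
        using r 1 by (simp add: ball ennreal_mult)
    next
      case 2
      have sq: "x < (cmod z)\<^sup>2 \<longleftrightarrow> sqrt x < cmod z" for z
        using real_sqrt_less_iff[of x "(cmod z)\<^sup>2"] by simp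
      have A_eq: "?A = ball 0 r - cball 0 (sqrt x)"
        by (simp only: set_eq_iff Int_iff Diff_iff mem_Collect_eq mem_cball_0 sq not_le) blast
      moreover have "cball 0 (sqrt x) \<subseteq> ball (0::complex) r"
        using 2 r real_sqrt_less_iff[of x "r\<^sup>2"] by (intro cball_subset_ball_iff[THEN iffD2]) simp
      ultimately have "emeasure lborel ?A = ennreal (pi * r\<^sup>2) - ennreal (pi * x)"
        using 2 r by (subst A_eq, subst emeasure_Diff) (auto simp: ball cball)
      also have "\<dots> = ennreal (pi * (r\<^sup>2 - max 0 x))"
        using 2 by (subst ennreal_minus) (auto simp: algebra_simps max_def)
      finally show ?thesis unfolding M N
      proof (intro conjI)
        have "{0..<r\<^sup>2} \<inter> {x<..} = {x<..<r\<^sup>2}" using 2 by auto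
        then show "ennreal pi * emeasure lborel ({0..<r\<^sup>2} \<inter> {x<..}) = ennreal (pi * (r\<^sup>2 - max 0 x))"
          using 2 by (simp add: ennreal_mult max_def)
      qed
    next
      case 3
      have "x \<ge> (cmod z)\<^sup>2" if "cmod z < r" for z
      proof -
        have "(cmod z)\<^sup>2 \<le> r\<^sup>2" using that by (intro power_mono) auto
        with 3 show ?thesis by simp
      qed
      then have "?A = {}" by (force simp: not_less)
      moreover have "{0..<r\<^sup>2} \<inter> {x<..} = {}" using 3 by auto
      moreover have "pi * (r\<^sup>2 - max 0 x) \<le> 0" 
        using 3 order_trans[OF zero_le_power2[of r] 3] by (simp add: mult_le_0_iff max_def)
      ultimately show ?thesis unfolding M N by (simp add: ennreal_neg)
    qed
  qed
  show "emeasure ?M {x<..} < \<infinity>" "emeasure ?M {x<..} = emeasure ?N {x<..}" for x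
    using *[of x] by auto
qed simp_all

text \<open>The integrand is a power of the squared modulus, so the pushforward turns the area
  integral into that of \<open>pi * s ^ n\<close> over an interval.\<close>

lemma disk_monomial_norm:
  assumes r: "r > 0"
  shows "(LINT z:ball 0 r|lborel. z ^ n * cnj z ^ n :: complex) = of_real (pi * r ^ (2 * n + 2) / (n + 1))"
proof -
  have [measurable]: "(indicator (ball (0::complex) r) :: complex \<Rightarrow> real) \<in> borel_measurable borel"
    by (intro borel_measurable_indicator) auto
  have zz: "z ^ n * cnj z ^ n = of_real (((cmod z)\<^sup>2) ^ n)" for z
    by (metis complex_norm_square of_real_power power_mult_distrib)
  have "(LINT z:ball 0 r|lborel. z ^ n * cnj z ^ n :: complex)
      = of_real (\<integral>z. indicator (ball 0 r) z * ((cmod z)\<^sup>2) ^ n \<partial>lborel)"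
    by (subst integral_complex_of_real[symmetric]) (simp add: set_lebesgue_integral_def zz scaleR_conv_of_real)
  also have "(\<integral>z. indicator (ball 0 r) z * ((cmod z)\<^sup>2) ^ n \<partial>lborel)
      = (\<integral>z. ((cmod z)\<^sup>2) ^ n \<partial>density lborel (indicator (ball (0::complex) r)))"
    by (subst integral_real_density[symmetric]) (auto simp: ennreal_indicator)
  also have "\<dots> = (\<integral>s. s ^ n \<partial>distr (density lborel (indicator (ball 0 r))) borel (\<lambda>z::complex. (cmod z)\<^sup>2))"
    by (subst integral_distr) auto
  also have "\<dots> = (\<integral>s. (pi * indicator {0..<r\<^sup>2} s) * s ^ n \<partial>lborel)"
    unfolding distr_disk_cmod_square[OF r]
    by (subst integral_real_density[symmetric]) (auto simp: ennreal_indicator ennreal_mult)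
  \<comment> \<open>Passing from the half-open to the closed interval changes the integrand at the
    null point \<open>r\<^sup>2\<close> only.\<close>
  also have "\<dots> = pi * (\<integral>s. s ^ n * indicator {0..r\<^sup>2} s \<partial>lborel)"
    by (subst integral_mult_right_zero[symmetric], intro integral_cong_AE)
      (use AE_lborel_singleton[of "r\<^sup>2"] in \<open>auto simp: indicator_def\<close>)
  also have "(\<integral>s. s ^ n * indicator {0..r\<^sup>2} s \<partial>lborel) = (r\<^sup>2) ^ (n + 1) / (n + 1)"
    using integral_power[of 0 "r\<^sup>2" n] by simp
  finally show ?thesis
    by (simp add: power_mult power_add power2_eq_square mult.assoc)
qed

lemma set_integrable_ball_continuous:
  fixes f :: "complex \<Rightarrow> complex"
  assumes "continuous_on (cball 0 r) f"
  shows "set_integrable lborel (ball 0 r) f"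
proof -
  have "set_integrable lborel (cball 0 r) f"
    unfolding set_integrable_def by (intro borel_integrable_compact assms) auto
  then show ?thesis
    by (rule set_integrable_subset) auto
qed

lemma disk_area_polynomial:
  fixes b :: "nat \<Rightarrow> complex"
  assumes r: "r > 0"
  shows "(LINT z:ball 0 r|lborel. (cmod (\<Sum>n<N. b n * z ^ n))\<^sup>2)
    = (\<Sum>n<N. (cmod (b n))\<^sup>2 * (pi * r ^ (2 * n + 2) / (n + 1)))"
proof -
  have int: "set_integrable lborel (ball 0 r) (\<lambda>z::complex. b m * cnj (b n) * (z ^ m * cnj z ^ n))" for m n
    by (intro set_integrable_ball_continuous continuous_intros)
  have "complex_of_real (LINT z:ball 0 r|lborel. (cmod (\<Sum>n<N. b n * z ^ n))\<^sup>2)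
      = (LINT z:ball 0 r|lborel. (\<Sum>m<N. \<Sum>n<N. b m * cnj (b n) * (z ^ m * cnj z ^ n)))"
    unfolding set_integral_complex_of_real[symmetric]
    by (simp only: complex_norm_square cnj_sum complex_cnj_mult complex_cnj_power sum_product mult_ac)
  also have "\<dots> = (\<Sum>m<N. \<Sum>n<N. LINT z:ball 0 r|lborel. b m * cnj (b n) * (z ^ m * cnj z ^ n))"
  proof -
    note int = int[unfolded set_integrable_def]
    show ?thesis
      unfolding set_lebesgue_integral_def scaleR_sum_right
      by (rule trans[OF Bochner_Integration.integral_sum[OF Bochner_Integration.integrable_sum[OF int]]],
          rule sum.cong[OF refl Bochner_Integration.integral_sum[OF int]])
  qed
  also have "\<dots> = (\<Sum>m<N. \<Sum>n<N. if m = n then of_real ((cmod (b n))\<^sup>2 * (pi * r ^ (2 * n + 2) / (n + 1))) else 0)"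
    by (intro sum.cong refl)
      (simp add: disk_monomials_orthogonal disk_monomial_norm[OF r] complex_mult_cnj cmod_power2)
  also have "\<dots> = of_real (\<Sum>n<N. (cmod (b n))\<^sup>2 * (pi * r ^ (2 * n + 2) / (n + 1)))"
    by (simp add: sum.delta)
  finally show ?thesis
    by (simp only: of_real_eq_iff)
qed

section \<open>Area integrals of power series and of their derivatives\<close>

text \<open>Strictly inside the disk of convergence all partial sums are bounded by one constant, so
  dominated convergence carries the polynomial formula over to the limit.\<close>

lemma disk_area_power_series:
  fixes b :: "nat \<Rightarrow> complex"
  assumes r: "0 < r" "r < R" and sums: "\<And>z. cmod z < R \<Longrightarrow> (\<lambda>n. b n * z ^ n) sums g z"
  shows "set_integrable lborel (ball 0 r) (\<lambda>z. (cmod (g z))\<^sup>2)" (is ?int)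
    and "(\<lambda>n. (cmod (b n))\<^sup>2 * (pi * r ^ (2 * n + 2) / (n + 1))) sums (LINT z:ball 0 r|lborel. (cmod (g z))\<^sup>2)"
proof -
  define P where "P N z = (\<Sum>n<N. b n * z ^ n)" for N and z :: complex
  \<comment> \<open>Convergence at a point of modulus strictly between r and R is what yields
    absolute convergence at r.\<close>
  have "summable (\<lambda>n. b n * (complex_of_real ((r + R) / 2)) ^ n)"
    using r by (intro sums_summable[OF sums]) (simp del: of_real_divide of_real_add)
  then have summ: "summable (\<lambda>n. cmod (b n) * r ^ n)"
    using powser_insidea[of b "complex_of_real ((r + R) / 2)" "complex_of_real r"] r
    by (simp add: norm_mult norm_power del: of_real_divide of_real_add)
  define B where "B = (\<Sum>n. cmod (b n) * r ^ n)"
  have bound: "cmod (P N z) \<le> B" if "cmod z < r" for N z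
  proof -
    have "cmod (P N z) \<le> (\<Sum>n<N. cmod (b n) * r ^ n)"
      unfolding P_def using that
      by (intro sum_norm_le) (auto simp: norm_mult norm_power intro!: mult_left_mono power_mono)
    also have "\<dots> \<le> B"
      unfolding B_def using r by (intro sum_le_suminf summ) auto
    finally show ?thesis .
  qed
  have B: "B \<ge> 0"
    using bound[of 0 0] r norm_ge_zero order_trans by (metis norm_zero)
  have [measurable]: "ball (0::complex) r \<in> sets borel"
    by simp
  have [measurable]: "(\<lambda>z. indicator (ball 0 r) z *\<^sub>R (cmod (P N z))\<^sup>2) \<in> borel_measurable lborel" for N
    unfolding P_def by measurable
  have hol: "continuous_on (ball 0 r) g"
  proof -
    have "g holomorphic_on ball 0 R"
      by (rule power_series_holomorphic[where a = b]) (simp add: sums)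
    then show ?thesis
      using r by (meson holomorphic_on_imp_continuous_on holomorphic_on_subset subset_ball less_imp_le)
  qed
  then have "continuous_on (ball 0 r) (\<lambda>z. (cmod (g z))\<^sup>2)"
    by (intro continuous_intros)
  then have m[measurable]: "(\<lambda>z. indicator (ball 0 r) z *\<^sub>R (cmod (g z))\<^sup>2) \<in> borel_measurable lborel"
    using borel_measurable_continuous_on_indicator[of "ball 0 r" "\<lambda>z. (cmod (g z))\<^sup>2"] by simp
  have "emeasure lborel (ball (0::complex) r) < \<infinity>"
    by (simp add: emeasure_ball r less_imp_le)
  then have w: "integrable lborel (\<lambda>z::complex. indicator (ball 0 r) z *\<^sub>R B\<^sup>2)"
    by (intro integrable_scaleR_left) auto
  have lim: "AE z in lborel. (\<lambda>N. indicator (ball 0 r) z *\<^sub>R (cmod (P N z))\<^sup>2) \<longlonglongrightarrow> indicator (ball 0 r) z *\<^sub>R (cmod (g z))\<^sup>2"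
  proof (rule AE_I2)
    fix z :: complex
    have "(\<lambda>N. P N z) \<longlonglongrightarrow> g z" if "cmod z < r"
      using sums[of z] that r by (simp add: sums_def P_def)
    then show "(\<lambda>N. indicator (ball 0 r) z *\<^sub>R (cmod (P N z))\<^sup>2) \<longlonglongrightarrow> indicator (ball 0 r) z *\<^sub>R (cmod (g z))\<^sup>2"
      by (cases "cmod z < r") (auto intro!: tendsto_intros)
  qed
  have dom: "AE z in lborel. norm (indicator (ball 0 r) z *\<^sub>R (cmod (P N z))\<^sup>2) \<le> indicator (ball 0 r) z *\<^sub>R B\<^sup>2" for N
    by (rule AE_I2) (auto simp: indicator_def intro!: power_mono bound)
  show ?int
    unfolding set_integrable_def
    by (rule integrable_dominated_convergence[OF m _ w lim dom]) measurable
  have "(\<lambda>N. LINT z:ball 0 r|lborel. (cmod (P N z))\<^sup>2) \<longlonglongrightarrow> (LINT z:ball 0 r|lborel. (cmod (g z))\<^sup>2)"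
    unfolding set_lebesgue_integral_def
    by (rule integral_dominated_convergence[OF m _ w lim dom]) measurable
  then show "(\<lambda>n. (cmod (b n))\<^sup>2 * (pi * r ^ (2 * n + 2) / (n + 1))) sums (LINT z:ball 0 r|lborel. (cmod (g z))\<^sup>2)"
    unfolding sums_def P_def disk_area_polynomial[OF r(1)] .
qed

text \<open>No dominating function exists on the whole disk in general. Both sides increase with the
  radius, so monotone convergence lets the radius tend to 1, and the identity also holds when both
  sides are infinite.\<close>

lemma unit_disk_area_power_series:
  fixes b :: "nat \<Rightarrow> complex"
  assumes sums: "\<And>z. cmod z < 1 \<Longrightarrow> (\<lambda>n. b n * z ^ n) sums g z"
  shows "(\<integral>\<^sup>+z\<in>ball 0 1. ennreal ((cmod (g z))\<^sup>2) \<partial>lborel) = (\<Sum>n. ennreal ((cmod (b n))\<^sup>2 * (pi / (n + 1))))"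
proof -
  \<comment> \<open>The shift by 2 makes the sequence start at 1/2, so that every radius is
    positive.\<close>
  define r where "r k = 1 - 1 / (real k + 2)" for k :: nat
  have r: "0 < r k" "r k < 1" for k
    by (auto simp: r_def field_simps)
  have r_mono: "r j \<le> r k" if "j \<le> k" for j k
    using that by (simp add: r_def frac_le)
  have r_lim: "r \<longlonglongrightarrow> 1"
    unfolding r_def by real_asymp
  define c where "c k n = (cmod (b n))\<^sup>2 * (pi * r k ^ (2 * n + 2) / (n + 1))" for k n
  have c_nonneg: "c k n \<ge> 0" for k n
    unfolding c_def
    by (intro mult_nonneg_nonneg divide_nonneg_nonneg zero_le_power zero_le_power2 less_imp_le[OF r(1)] pi_ge_zero of_nat_0_le_iff)
  have "g holomorphic_on ball 0 1"
    by (rule power_series_holomorphic[where a = b]) (simp add: sums)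
  then have "continuous_on (ball 0 1) g"
    by (rule holomorphic_on_imp_continuous_on)
  then have "continuous_on (ball 0 1) (\<lambda>z. (cmod (g z))\<^sup>2)"
    by (intro continuous_intros)
  then have m[measurable]: "(\<lambda>z. indicator (ball 0 1) z *\<^sub>R (cmod (g z))\<^sup>2) \<in> borel_measurable borel"
    using borel_measurable_continuous_on_indicator[of "ball 0 1" "\<lambda>z. (cmod (g z))\<^sup>2"] by simp
  define f where "f k z = ennreal (indicator (ball 0 1) z *\<^sub>R (cmod (g z))\<^sup>2) * indicator (ball 0 (r k)) z" for k z
  have [measurable]: "ball (0::complex) \<rho> \<in> sets borel" for \<rho>
    by simp
  have "(\<integral>\<^sup>+z. f k z \<partial>lborel) = (\<Sum>n. ennreal (c k n))" for k
  proof -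
    note * = disk_area_power_series[OF r(1) r(2) sums, of k]
    have "(\<integral>\<^sup>+z. f k z \<partial>lborel) = (\<integral>\<^sup>+z. ennreal (indicator (ball 0 (r k)) z *\<^sub>R (cmod (g z))\<^sup>2) \<partial>lborel)"
      using r[of k] by (intro nn_integral_cong) (auto simp: f_def indicator_def)
    also have "\<dots> = ennreal (LINT z:ball 0 (r k)|lborel. (cmod (g z))\<^sup>2)"
      using *(1) unfolding set_lebesgue_integral_def set_integrable_def
      by (intro nn_integral_eq_integral) auto
    also have "\<dots> = (\<Sum>n. ennreal (c k n))"
    proof -
      have "c k sums (LINT z:ball 0 (r k)|lborel. (cmod (g z))\<^sup>2)"
        using *(2) unfolding c_def .
      from sums_unique[OF this] sums_summable[OF this] show ?thesis
        by (simp add: suminf_ennreal2 c_nonneg)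
    qed
    finally show ?thesis .
  qed
  \<comment> \<open>Writing the series as an integral over the counting measure puts both sides
    under the same monotone convergence theorem.\<close>
  then have eq: "(\<integral>\<^sup>+z. f k z \<partial>lborel) = (\<integral>\<^sup>+n. ennreal (c k n) \<partial>count_space UNIV)" for k
    by (simp add: nn_integral_count_space_nat)
  have "(\<lambda>k. \<integral>\<^sup>+z. f k z \<partial>lborel) \<longlonglongrightarrow> (\<integral>\<^sup>+z\<in>ball 0 1. ennreal ((cmod (g z))\<^sup>2) \<partial>lborel)"
  proof (rule nn_integral_LIMSEQ)
    show "incseq f"
    proof (intro monoI le_funI)
      fix j k :: nat and z assume "j \<le> k"
      then show "f j z \<le> f k z"
        using r_mono[of j k] by (simp add: f_def indicator_def)
    qed
    show "f k \<in> borel_measurable lborel" for k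
      unfolding f_def by measurable
    show "(\<lambda>k. f k z) \<longlonglongrightarrow> ennreal ((cmod (g z))\<^sup>2) * indicator (ball 0 1) z" for z
    proof (cases "cmod z < 1")
      case True
      then have "\<forall>\<^sub>F k in sequentially. cmod z < r k"
        using order_tendstoD(1)[OF r_lim] by blast
      then have "\<forall>\<^sub>F k in sequentially. f k z = ennreal ((cmod (g z))\<^sup>2) * indicator (ball 0 1) z"
        by eventually_elim (use True in \<open>auto simp: f_def\<close>)
      then show ?thesis
        by (rule tendsto_eventually)
    qed (auto simp: f_def)
  qed
  moreover have "(\<lambda>k. \<integral>\<^sup>+n. ennreal (c k n) \<partial>count_space UNIV) \<longlonglongrightarrow> (\<integral>\<^sup>+n. ennreal ((cmod (b n))\<^sup>2 * (pi / (n + 1))) \<partial>count_space UNIV)"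
  proof (rule nn_integral_LIMSEQ)
    show "incseq (\<lambda>k n. ennreal (c k n))"
    proof (intro monoI le_funI)
      fix j k n :: nat assume "j \<le> k"
      then show "ennreal (c j n) \<le> ennreal (c k n)"
        unfolding c_def using r r_mono[of j k]
        by (intro ennreal_leI mult_left_mono divide_right_mono power_mono) (auto intro: less_imp_le)
    qed
    have "(\<lambda>k. c k n) \<longlonglongrightarrow> (cmod (b n))\<^sup>2 * (pi * 1 ^ (2 * n + 2) / (n + 1))" for n
      unfolding c_def by (intro tendsto_intros r_lim) auto
    then show "(\<lambda>k. ennreal (c k n)) \<longlonglongrightarrow> ennreal ((cmod (b n))\<^sup>2 * (pi / (n + 1)))" for n
      by (intro tendsto_ennrealI) simp
  qed simp
  ultimately show ?thesis
    unfolding eq nn_integral_count_space_nat by (rule LIMSEQ_unique)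
qed

lemma nn_integral_deriv_power_series:
  fixes a :: "nat \<Rightarrow> complex"
  assumes sums: "\<And>z. cmod z < 1 \<Longrightarrow> (\<lambda>n. a n * z ^ n) sums f z"
  shows "(\<integral>\<^sup>+z\<in>ball 0 1. ennreal ((cmod (deriv f z))\<^sup>2) \<partial>lborel) = (\<Sum>n. ennreal (pi * real n * (cmod (a n))\<^sup>2))"
proof -
  define b where "b n = of_nat (Suc n) * a (Suc n)" for n
  have "(\<lambda>n. b n * z ^ n) sums deriv f z" if z: "cmod z < 1" for z
  proof -
    \<comment> \<open>The termwise differentiation lemma needs convergence at a point of larger
      modulus than z that is still inside the disk.\<close>
    define r where "r = (1 + cmod z) / 2"
    have r: "cmod z < r" "r < 1" "0 \<le> r"
      using z by (auto simp: r_def intro: add_nonneg_nonneg)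
    have "summable (\<lambda>n. a n * of_real (r ^ n))"
      unfolding of_real_power using r by (intro sums_summable[OF sums]) simp
    from power_series_and_derivative_0[OF this] obtain g g' where
      g: "\<And>w. cmod w < r \<Longrightarrow> (\<lambda>n. a n * w ^ n) sums g w"
         "\<And>w. cmod w < r \<Longrightarrow> (\<lambda>n. of_nat n * a n * w ^ (n - 1)) sums g' w"
         "\<And>w. cmod w < r \<Longrightarrow> (g has_field_derivative g' w) (at w)"
      by blast
    have "(f has_field_derivative g' z) (at z)"
    proof (rule has_field_derivative_transform_within_open[OF g(3)[OF r(1)], of "ball 0 r"])
      show "g w = f w" if "w \<in> ball 0 r" for w
        using sums[of w] g(1)[of w] that r by (intro sums_unique2[of "\<lambda>n. a n * w ^ n"]) auto
    qed (use r in auto)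
    then have "deriv f z = g' z"
      by (rule DERIV_imp_deriv)
    then show ?thesis
      using g(2)[OF r(1)] sums_Suc_iff[of "\<lambda>n. of_nat n * a n * z ^ (n - 1)" "g' z"]
      by (simp add: b_def)
  qed
  note area = unit_disk_area_power_series[OF this]
  have b: "(cmod (b n))\<^sup>2 * (pi / (n + 1)) = pi * real (Suc n) * (cmod (a (Suc n)))\<^sup>2" for n
    unfolding b_def by (simp add: norm_mult power2_eq_square del: of_nat_Suc)
  \<comment> \<open>The derivative has lost the constant term; putting back the index 0 is free
    because its summand carries the factor \<open>real n\<close>.\<close>
  have "(\<lambda>n. ennreal (pi * real (Suc n) * (cmod (a (Suc n)))\<^sup>2)) sums (\<Sum>n. ennreal (pi * real (Suc n) * (cmod (a (Suc n)))\<^sup>2))"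
    by (intro summable_sums summableI)
  from sums_unique[OF sums_Suc[OF this]] show ?thesis
    by (simp only: area b) simp
qed

section \<open>Generating function of the Laguerre polynomials\<close>

text \<open>The closed form is taken as definition because the generating function and all moments
  can be computed from it term by term.\<close>

definition laguerre :: "nat \<Rightarrow> real \<Rightarrow> real" where
  "laguerre n x = (\<Sum>k\<le>n. real (n choose k) * (- x) ^ k / fact k)"

lemma laguerre_0 [simp]: "laguerre 0 x = 1"
  by (simp add: laguerre_def)

lemma borel_measurable_laguerre [measurable]: "laguerre n \<in> borel_measurable borel"
  unfolding laguerre_def by measurable

lemma powser_norm_summable_in_disk:
  fixes w :: "'a :: {real_normed_field, banach}"
  assumes "norm w < K" "\<And>z. norm z < K \<Longrightarrow> summable (\<lambda>n. c n * z ^ n)"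
  shows "summable (\<lambda>n. norm (c n * w ^ n))"
proof -
  obtain r where r: "norm w < r" "r < K"
    using assms(1) dense by blast
  moreover have "0 \<le> r"
    using r(1) norm_ge_zero[of w] by linarith
  ultimately show ?thesis
    by (intro powser_insidea[OF assms(2)[of "of_real r"]]) auto
qed

text \<open>Each further factor 1 / (1 - w) is a Cauchy product with the geometric series, and the
  resulting finite sums of binomial coefficients collapse by the hockey-stick identity
  \<open>choose_rising_sum\<close>.\<close>

lemma sums_rising_binomial:
  fixes w :: "'a :: {real_normed_field, banach}"
  assumes "norm w < 1"
  shows "(\<lambda>n. of_nat ((n + k) choose k) * w ^ n) sums (1 / (1 - w) ^ Suc k)"
  using assms
proof (induction k arbitrary: w)
  case 0
  then show ?case using geometric_sums[of w] by simp
next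
  case (Suc k)
  have "summable (\<lambda>n. of_nat ((n + k) choose k) * z ^ n)" if "norm z < 1" for z :: 'a
    using Suc.IH[OF that] by (rule sums_summable)
  then have "summable (\<lambda>n. norm (of_nat ((n + k) choose k) * w ^ n))"
    by (rule powser_norm_summable_in_disk[OF Suc.prems])
  moreover have "summable (\<lambda>n. norm (w ^ n))"
    using Suc.prems by (simp add: norm_power)
  ultimately have "(\<lambda>n. \<Sum>i\<le>n. (of_nat ((i + k) choose k) * w ^ i) * w ^ (n - i)) sums
      ((\<Sum>n. of_nat ((n + k) choose k) * w ^ n) * (\<Sum>n. w ^ n))"
    by (rule Cauchy_product_sums)
  also have "(\<Sum>n. of_nat ((n + k) choose k) * w ^ n) * (\<Sum>n. w ^ n) = 1 / (1 - w) ^ Suc (Suc k)"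
    by (simp add: sums_unique[OF Suc.IH[OF Suc.prems], symmetric]
        sums_unique[OF geometric_sums[OF Suc.prems], symmetric])
  also have "(\<lambda>n. \<Sum>i\<le>n. (of_nat ((i + k) choose k) * w ^ i) * w ^ (n - i))
      = (\<lambda>n. of_nat ((n + Suc k) choose Suc k) * w ^ n)"
  proof
    fix n
    have "(\<Sum>i\<le>n. (of_nat ((i + k) choose k) * w ^ i) * w ^ (n - i))
        = (\<Sum>i\<le>n. of_nat ((k + i) choose k) * w ^ n)"
      by (intro sum.cong) (auto simp: mult.assoc add.commute simp flip: power_add)
    also have "\<dots> = of_nat (\<Sum>i\<le>n. (k + i) choose k) * w ^ n"
      by (simp add: sum_distrib_right)
    finally show "(\<Sum>i\<le>n. (of_nat ((i + k) choose k) * w ^ i) * w ^ (n - i))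
        = of_nat ((n + Suc k) choose Suc k) * w ^ n"
      unfolding choose_rising_sum(1) by (simp add: add.commute)
  qed
  finally show ?case .
qed

lemma sums_binomial_column:
  fixes w :: "'a :: {real_normed_field, banach}"
  assumes "norm w < 1"
  shows "(\<lambda>n. of_nat (n choose k) * w ^ n) sums (w ^ k / (1 - w) ^ Suc k)"
proof -
  have "(\<lambda>n. w ^ k * (of_nat ((n + k) choose k) * w ^ n)) sums (w ^ k * (1 / (1 - w) ^ Suc k))"
    by (intro sums_mult sums_rising_binomial assms)
  then have "(\<lambda>n. of_nat ((n + k) choose k) * w ^ (n + k)) sums (w ^ k / (1 - w) ^ Suc k)"
    by (simp add: power_add mult_ac)
  moreover have "(\<Sum>i<k. of_nat (i choose k) * w ^ i) = 0"
    by (intro sum.neutral) auto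
  ultimately show ?thesis
    by (subst (asm) sums_iff_shift) simp
qed

text \<open>The unconditional form is required because the generating function interchanges a double
  sum.\<close>

lemma has_sum_binomial_column:
  fixes w :: "'a :: {real_normed_field, banach}"
  assumes "norm w < 1"
  shows "((\<lambda>n. of_nat (n choose k) * w ^ n) has_sum (w ^ k / (1 - w) ^ Suc k)) UNIV"
proof (rule norm_summable_imp_has_sum)
  show "summable (\<lambda>n. norm (of_nat (n choose k) * w ^ n))"
    using sums_binomial_column[of "norm w" k] assms by (auto simp: norm_mult norm_power intro: sums_summable)
qed (rule sums_binomial_column[OF assms])

lemma has_sum_exp:
  fixes z :: "'a :: {real_normed_field, banach}"
  shows "((\<lambda>k. z ^ k / fact k) has_sum exp z) UNIV"
proof (rule norm_summable_imp_has_sum)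
  show "summable (\<lambda>k. norm (z ^ k / fact k))"
    using summable_norm_exp[of z] by (simp add: scaleR_conv_of_real divide_inverse norm_mult norm_inverse mult.commute)
  show "(\<lambda>k. z ^ k / fact k) sums exp z"
    using exp_converges[of z] by (simp add: scaleR_conv_of_real divide_inverse mult.commute)
qed

text \<open>Insert the closed form of the polynomials and sum over n first: for fixed k a column of
  Pascal's triangle gives \<open>w ^ k / (1 - w) ^ Suc k\<close>, and what remains is an exponential
  series in k.\<close>

lemma laguerre_generating_function:
  fixes w :: complex
  assumes w: "cmod w < 1"
  shows "summable (\<lambda>n. cmod (of_real (laguerre n x) * w ^ n))"
    and "(\<lambda>n. of_real (laguerre n x) * w ^ n) sums (exp (- of_real x * w / (1 - w)) / (1 - w))"
proof -
  define F :: "real \<Rightarrow> complex \<Rightarrow> nat \<times> nat \<Rightarrow> complex" where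
    "F y v = (\<lambda>(k, n). of_real y ^ k / fact k * (of_nat (n choose k) * v ^ n))" for y v
  \<comment> \<open>The same double family at \<bar>x\<bar> and |w|. The very computation that
    evaluates the double sum shows that this majorant is summable, which justifies the
    interchange.\<close>
  define G :: "nat \<times> nat \<Rightarrow> real" where
    "G = (\<lambda>(k, n). \<bar>x\<bar> ^ k / fact k * (real (n choose k) * cmod w ^ n))"
  have inner: "((\<lambda>n. G (k, n)) has_sum (\<bar>x\<bar> ^ k / fact k * (cmod w ^ k / (1 - cmod w) ^ Suc k))) UNIV" for k
    unfolding G_def split using w by (intro has_sum_cmult_right has_sum_binomial_column) simp
  have "((\<lambda>k. 1 / (1 - cmod w) * ((\<bar>x\<bar> * cmod w / (1 - cmod w)) ^ k / fact k)) has_sum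
      (1 / (1 - cmod w) * exp (\<bar>x\<bar> * cmod w / (1 - cmod w)))) UNIV"
    by (intro has_sum_cmult_right has_sum_exp)
  then have outer: "(\<lambda>k. \<bar>x\<bar> ^ k / fact k * (cmod w ^ k / (1 - cmod w) ^ Suc k)) summable_on UNIV"
    by (intro has_sum_imp_summable) (simp add: power_mult_distrib power_divide mult_ac)
  have G_summable: "G summable_on (UNIV \<times> UNIV)"
    by (rule summable_on_SigmaI[OF inner outer]) (auto simp: G_def)
  have norm_F: "cmod (F (- x) w p) = G p" for p
    by (auto simp: F_def G_def norm_mult norm_divide norm_power split: prod.split)
  have F_summable: "F (- x) w summable_on (UNIV \<times> UNIV)"
    by (rule abs_summable_summable) (use G_summable in \<open>simp add: norm_F\<close>)
  have "((\<lambda>k. 1 / (1 - w) * ((of_real (- x) * w / (1 - w)) ^ k / fact k)) has_sum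
      (1 / (1 - w) * exp (of_real (- x) * w / (1 - w)))) UNIV"
    by (intro has_sum_cmult_right has_sum_exp)
  also have "(\<lambda>k. 1 / (1 - w) * ((of_real (- x) * w / (1 - w)) ^ k / fact k))
      = (\<lambda>k. of_real (- x) ^ k / fact k * (w ^ k / (1 - w) ^ Suc k))"
    by (simp only: power_mult_distrib power_divide power_Suc times_divide_eq_left times_divide_eq_right
        divide_divide_eq_left mult_1 mult_ac)
  also have "1 / (1 - w) * exp (of_real (- x) * w / (1 - w)) = exp (- of_real x * w / (1 - w)) / (1 - w)"
    by simp
  finally have "((\<lambda>k. of_real (- x) ^ k / fact k * (w ^ k / (1 - w) ^ Suc k)) has_sum
      (exp (- of_real x * w / (1 - w)) / (1 - w))) UNIV" .
  moreover have "((\<lambda>n. F (- x) w (k, n)) has_sum (of_real (- x) ^ k / fact k * (w ^ k / (1 - w) ^ Suc k))) UNIV" for k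
    unfolding F_def split using w by (intro has_sum_cmult_right has_sum_binomial_column) simp
  ultimately have "(F (- x) w has_sum (exp (- of_real x * w / (1 - w)) / (1 - w))) (UNIV \<times> UNIV)"
    using F_summable by (intro has_sum_SigmaI[where g = "\<lambda>k. of_real (- x) ^ k / fact k * (w ^ k / (1 - w) ^ Suc k)"]) auto
  then have swapped: "((\<lambda>(n, k). F (- x) w (k, n)) has_sum (exp (- of_real x * w / (1 - w)) / (1 - w))) (UNIV \<times> UNIV)"
    by (subst (asm) has_sum_swap)
  \<comment> \<open>For k > n the binomial coefficient vanishes, so a row is the finite sum that
    defines the polynomial.\<close>
  have row: "((\<lambda>k. F (- x) w (k, n)) has_sum (of_real (laguerre n x) * w ^ n)) UNIV" for n
  proof (subst has_sum_cong_neutral[where T = "{..n}" and g = "\<lambda>k. F (- x) w (k, n)"])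
    show "((\<lambda>k. F (- x) w (k, n)) has_sum (of_real (laguerre n x) * w ^ n)) {..n}"
      by (intro has_sum_finiteI) (auto simp: F_def laguerre_def sum_distrib_right intro!: sum.cong)
  qed (auto simp: F_def)
  have total: "((\<lambda>n. of_real (laguerre n x) * w ^ n) has_sum (exp (- of_real x * w / (1 - w)) / (1 - w))) UNIV"
    by (rule has_sum_SigmaD[OF swapped]) (simp add: row)
  show "(\<lambda>n. of_real (laguerre n x) * w ^ n) sums (exp (- of_real x * w / (1 - w)) / (1 - w))"
    using total by (rule has_sum_imp_sums)
  have "(\<lambda>n. of_real (laguerre n x) * w ^ n) summable_on UNIV"
    using total by (rule has_sum_imp_summable)
  then show "summable (\<lambda>n. cmod (of_real (laguerre n x) * w ^ n))"
    by (subst (asm) summable_on_iff_abs_summable_on_complex) (rule summable_on_imp_summable)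
qed

text \<open>Differentiate the previous identity in w. The last factor is L_1 evaluated at x / (1 -
  w), which is how L_1 enters the kernel.\<close>

lemma laguerre_generating_function_deriv:
  fixes w :: complex
  assumes w: "cmod w < 1"
  shows "summable (\<lambda>n. cmod (of_nat (Suc n) * of_real (laguerre (Suc n) x) * w ^ n))"
    and "(\<lambda>n. of_nat (Suc n) * of_real (laguerre (Suc n) x) * w ^ n) sums
      (exp (- of_real x * w / (1 - w)) / (1 - w)\<^sup>2 * (1 - of_real x / (1 - w)))"
proof -
  define c where "c n = complex_of_real (laguerre n x)" for n
  have diffs: "diffs c = (\<lambda>n. of_nat (Suc n) * of_real (laguerre (Suc n) x))"
    by (simp add: diffs_def c_def)
  have summ: "summable (\<lambda>n. c n * z ^ n)" if "cmod z < 1" for z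
    using laguerre_generating_function(2)[OF that, of x] by (auto simp: c_def intro: sums_summable)
  have summ': "summable (\<lambda>n. diffs c n * z ^ n)" if "cmod z < 1" for z
    using that summ by (rule termdiff_converges)
  have "summable (\<lambda>n. cmod (diffs c n * w ^ n))"
    by (rule powser_norm_summable_in_disk[OF w summ'])
  then show "summable (\<lambda>n. cmod (of_nat (Suc n) * of_real (laguerre (Suc n) x) * w ^ n))"
    unfolding diffs .
  have ne: "1 - w \<noteq> 0"
    using w by auto
  have 1: "((\<lambda>z. \<Sum>n. c n * z ^ n) has_field_derivative (\<Sum>n. diffs c n * w ^ n)) (at w)"
    by (rule termdiffs_strong'[OF summ w])
  have ne2: "(1 - w) * (1 - w) \<noteq> 0"
    using ne by simp
  have "((\<lambda>z. - of_real x * z / (1 - z)) has_field_derivative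
      ((- of_real x * (1 - w) - (- of_real x * w) * (- 1)) / ((1 - w) * (1 - w)))) (at w)"
    by (rule DERIV_divide) (use ne in \<open>auto intro!: derivative_eq_intros\<close>)
  also have "(- of_real x * (1 - w) - (- of_real x * w) * (- 1)) = - complex_of_real x"
    by (simp add: algebra_simps)
  finally have "((\<lambda>z. exp (- of_real x * z / (1 - z)) / (1 - z)) has_field_derivative
      ((exp (- of_real x * w / (1 - w)) * (- of_real x / ((1 - w) * (1 - w)))) * (1 - w)
        - exp (- of_real x * w / (1 - w)) * (- 1)) / ((1 - w) * (1 - w))) (at w)"
    by (intro DERIV_divide DERIV_fun_exp ne) (auto intro!: derivative_eq_intros)
  also have "((exp (- of_real x * w / (1 - w)) * (- of_real x / ((1 - w) * (1 - w)))) * (1 - w)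
        - exp (- of_real x * w / (1 - w)) * (- 1)) / ((1 - w) * (1 - w))
      = exp (- of_real x * w / (1 - w)) / (1 - w)\<^sup>2 * (1 - of_real x / (1 - w))"
    using ne by (simp add: power2_eq_square divide_simps) (simp add: algebra_simps)
  finally have "((\<lambda>z. exp (- of_real x * z / (1 - z)) / (1 - z)) has_field_derivative
      (exp (- of_real x * w / (1 - w)) / (1 - w)\<^sup>2 * (1 - of_real x / (1 - w)))) (at w)"
    .
  then have "((\<lambda>z. \<Sum>n. c n * z ^ n) has_field_derivative
      (exp (- of_real x * w / (1 - w)) / (1 - w)\<^sup>2 * (1 - of_real x / (1 - w)))) (at w)"
  proof (rule has_field_derivative_transform_within_open[of _ _ _ "ball 0 1"])
    show "exp (- of_real x * z / (1 - z)) / (1 - z) = (\<Sum>n. c n * z ^ n)" if "z \<in> ball 0 1" for z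
      using sums_unique[OF laguerre_generating_function(2)[of z x]] that by (simp add: c_def)
  qed (use w in auto)
  with 1 have "(\<Sum>n. diffs c n * w ^ n) = exp (- of_real x * w / (1 - w)) / (1 - w)\<^sup>2 * (1 - of_real x / (1 - w))"
    by (rule DERIV_unique)
  then show "(\<lambda>n. of_nat (Suc n) * of_real (laguerre (Suc n) x) * w ^ n) sums
      (exp (- of_real x * w / (1 - w)) / (1 - w)\<^sup>2 * (1 - of_real x / (1 - w)))"
    using summable_sums[OF summ'[OF w]] by (simp add: diffs)
qed

text \<open>Up to the sign (-1)^n this is the n-th forward difference at a of the map sending m to
  \<open>m choose j\<close>, and each difference lowers the lower index by one until the function
  becomes 0.\<close>

lemma alternating_binomial_sum:
  "(\<Sum>k\<le>n. (- 1) ^ k * real (n choose k) * real ((k + a) choose j))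
    = (if n \<le> j then (- 1) ^ n * real (a choose (j - n)) else 0)"
proof (induction n arbitrary: a)
  case 0
  show ?case by simp
next
  case (Suc n)
  define g where "g k = (- 1) ^ k * real ((k + a) choose j)" for k
  have "(\<Sum>k\<le>Suc n. (- 1) ^ k * real (Suc n choose k) * real ((k + a) choose j))
      = (\<Sum>k\<le>Suc n. real (Suc n choose k) * g k)"
    by (simp add: g_def mult_ac)
  also have "\<dots> = g 0 + (\<Sum>k\<le>n. real (Suc n choose Suc k) * g (Suc k))"
    by (subst sum.atMost_Suc_shift) simp
  \<comment> \<open>Pascal's rule splits the sum into the one for n at a and minus the one for n at
    a + 1; hence the induction with a arbitrary.\<close>
  also have "\<dots> = g 0 + (\<Sum>k\<le>n. real (n choose Suc k) * g (Suc k)) + (\<Sum>k\<le>n. real (n choose k) * g (Suc k))"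
    by (simp add: sum.distrib algebra_simps)
  also have "g 0 + (\<Sum>k\<le>n. real (n choose Suc k) * g (Suc k)) = (\<Sum>k\<le>Suc n. real (n choose k) * g k)"
    by (subst sum.atMost_Suc_shift) simp
  also have "\<dots> = (\<Sum>k\<le>n. (- 1) ^ k * real (n choose k) * real ((k + a) choose j))"
    by (simp add: g_def mult_ac)
  also have "(\<Sum>k\<le>n. real (n choose k) * g (Suc k))
      = - (\<Sum>k\<le>n. (- 1) ^ k * real (n choose k) * real ((k + Suc a) choose j))"
    by (simp add: g_def mult_ac sum_negf)
  finally have "(\<Sum>k\<le>Suc n. (- 1) ^ k * real (Suc n choose k) * real ((k + a) choose j))
      = (if n \<le> j then (- 1) ^ n * (real (a choose (j - n)) - real (Suc a choose (j - n))) else 0)"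
    unfolding Suc.IH by (simp add: right_diff_distrib del: binomial_Suc_Suc)
  moreover have "real (a choose (j - n)) - real (Suc a choose (j - n)) = - real (a choose (j - Suc n))" if "Suc n \<le> j"
  proof -
    from that have "j - n = Suc (j - Suc n)" by simp
    then show ?thesis by simp
  qed
  \<comment> \<open>This is the case n = j: both binomial coefficients have lower index 0, so they
    equal 1 and cancel.\<close>
  moreover have "j - n = 0" if "n \<le> j" "\<not> Suc n \<le> j"
    using that by simp
  ultimately show ?case by auto
qed

section \<open>Laguerre expansions in \<open>L\<^sup>2\<close>\<close>

lemma sets_laguerre_measure [measurable_cong, simp]: "sets laguerre_measure = sets borel"
  by (simp add: laguerre_measure_def)

lemma space_laguerre_measure [simp]: "space laguerre_measure = UNIV"
  by (simp add: laguerre_measure_def)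

lemma laguerre_measure_moment:
  "has_bochner_integral laguerre_measure (\<lambda>x. x ^ k) (fact k)"
  unfolding laguerre_measure_def
proof (rule has_bochner_integral_density)
  have "has_bochner_integral lborel (\<lambda>x::real. x ^ k * exp (- x) * indicator {0..} x) (fact k)"
  proof (rule has_bochner_integral_nn_integral)
    have "(\<integral>\<^sup>+ x. ennreal (x ^ k * exp (- x) * indicator {0..} x) \<partial>lborel)
        = (\<integral>\<^sup>+ x. ennreal (x ^ k * exp (- x)) * indicator {0..} x \<partial>lborel)"
      by (intro nn_integral_cong) (auto simp: indicator_def)
    then show "(\<integral>\<^sup>+ x. ennreal (x ^ k * exp (- x) * indicator {0..} x) \<partial>lborel) = ennreal (fact k)"
      using nn_intergal_power_times_exp_Ici[of k] by (simp add: of_nat_fact)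
  qed (auto simp: indicator_def)
  then show "has_bochner_integral lborel (\<lambda>x. (indicator {0..} x * exp (- x)) *\<^sub>R x ^ k) (fact k)"
    by (simp add: mult_ac)
qed auto

interpretation laguerre_measure: prob_space laguerre_measure
proof
  have "integral\<^sup>L laguerre_measure (\<lambda>x. 1) = (1 :: real)" "integrable laguerre_measure (\<lambda>x. 1 :: real)"
    using laguerre_measure_moment[of 0] by (auto simp: has_bochner_integral_iff)
  then show "emeasure laguerre_measure (space laguerre_measure) = 1"
    using nn_integral_eq_integral[of laguerre_measure "\<lambda>x. 1"] by simp
qed

lemma laguerre_altdef: "laguerre n x = (\<Sum>k\<le>n. (- 1) ^ k * real (n choose k) / fact k * x ^ k)"
  unfolding laguerre_def by (intro sum.cong refl, subst power_minus) simp

text \<open>The moment (k + j)! divided by k! is j! times a binomial coefficient, which leaves an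
  alternating binomial sum. In particular L_n is orthogonal to all powers below n.\<close>

lemma laguerre_moment:
  "has_bochner_integral laguerre_measure (\<lambda>x. laguerre n x * x ^ j) (fact j * (- 1) ^ n * real (j choose n))"
proof -
  have "has_bochner_integral laguerre_measure
      (\<lambda>x. \<Sum>k\<le>n. (- 1) ^ k * real (n choose k) / fact k * x ^ (k + j))
      (\<Sum>k\<le>n. (- 1) ^ k * real (n choose k) / fact k * fact (k + j))"
    by (intro has_bochner_integral_sum has_bochner_integral_mult_right laguerre_measure_moment)
  also have "(\<lambda>x. \<Sum>k\<le>n. (- 1) ^ k * real (n choose k) / fact k * x ^ (k + j)) = (\<lambda>x. laguerre n x * x ^ j)"
    by (simp add: laguerre_altdef sum_distrib_right power_add mult.assoc)
  also have "(\<Sum>k\<le>n. (- 1) ^ k * real (n choose k) / fact k * fact (k + j))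
      = fact j * (\<Sum>k\<le>n. (- 1) ^ k * real (n choose k) * real ((k + j) choose j))"
    unfolding sum_distrib_left
  proof (intro sum.cong refl)
    fix k assume "k \<in> {..n}"
    have "(fact (k + j) :: real) = fact j * fact k * real ((k + j) choose j)"
      using binomial_fact_lemma[of j "k + j"] by (metis add_diff_cancel_right' le_add2 of_nat_fact of_nat_mult)
    then show "(- 1) ^ k * real (n choose k) / fact k * fact (k + j)
        = fact j * ((- 1) ^ k * real (n choose k) * real ((k + j) choose j))"
      by simp
  qed
  also have "\<dots> = fact j * (- 1) ^ n * real (j choose n)"
  proof (cases "n \<le> j")
    case True
    then show ?thesis
      by (simp add: alternating_binomial_sum binomial_symmetric[of n j])
  qed (simp add: alternating_binomial_sum)
  finally show ?thesis .
qed

text \<open>Expand the polynomial of smaller degree into powers. The other one annihilates every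
  power below its own degree, so at most the top power counts, and only if the degrees
  agree.\<close>

lemma laguerre_orthonormal:
  "has_bochner_integral laguerre_measure (\<lambda>x. laguerre m x * laguerre n x) (if m = n then 1 else 0)"
proof -
  have le: "has_bochner_integral laguerre_measure (\<lambda>x. laguerre m x * laguerre n x) (if m = n then 1 else 0)"
    if mn: "m \<le> n" for m n
  proof -
    have "has_bochner_integral laguerre_measure
        (\<lambda>x. \<Sum>j\<le>m. (- 1) ^ j * real (m choose j) / fact j * (laguerre n x * x ^ j))
        (\<Sum>j\<le>m. (- 1) ^ j * real (m choose j) / fact j * (fact j * (- 1) ^ n * real (j choose n)))"
      by (intro has_bochner_integral_sum has_bochner_integral_mult_right laguerre_moment)
    also have "(\<lambda>x. \<Sum>j\<le>m. (- 1) ^ j * real (m choose j) / fact j * (laguerre n x * x ^ j))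
        = (\<lambda>x. laguerre m x * laguerre n x)"
      unfolding laguerre_altdef[of m] sum_distrib_right by (simp add: mult_ac)
    also have "(\<Sum>j\<le>m. (- 1) ^ j * real (m choose j) / fact j * (fact j * (- 1) ^ n * real (j choose n)))
        = (\<Sum>j\<le>m. if j = n then 1 else 0)"
    proof (intro sum.cong refl)
      fix j assume j: "j \<in> {..m}"
      consider "j < n" | "j = n" "m = n"
        using j mn by fastforce
      then show "(- 1) ^ j * real (m choose j) / fact j * (fact j * (- 1) ^ n * real (j choose n)) = (if j = n then 1 else 0)"
        by cases (auto simp flip: power_add)
    qed
    also have "\<dots> = (if m = n then 1 else 0)"
      using that by (simp add: sum.delta')
    finally show ?thesis .
  qed
  show ?thesis
    using le[of m n] le[of n m] by (cases "m \<le> n") (auto simp: mult.commute)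
qed

section \<open>Square integrable functions for the weight\<close>

lemma laguerre_L2_D:
  assumes "f \<in> laguerre_L2"
  shows "f \<in> borel_measurable borel" "integrable laguerre_measure (\<lambda>x. (cmod (f x))\<^sup>2)"
  using assms measurable_cong_sets[OF sets_laguerre_measure refl] by (auto simp: laguerre_L2_def)

lemma laguerre_L2_I:
  "f \<in> borel_measurable borel \<Longrightarrow> integrable laguerre_measure (\<lambda>x. (cmod (f x))\<^sup>2) \<Longrightarrow> f \<in> laguerre_L2"
  using measurable_cong_sets[OF sets_laguerre_measure refl] by (auto simp: laguerre_L2_def)

lemma laguerre_L2_lincomb:
  assumes f: "f \<in> laguerre_L2" and g: "g \<in> laguerre_L2"
  shows "(\<lambda>x. a * f x + b * g x) \<in> laguerre_L2"
proof (rule laguerre_L2_I)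
  note [measurable] = laguerre_L2_D(1)[OF f] laguerre_L2_D(1)[OF g]
  show "(\<lambda>x. a * f x + b * g x) \<in> borel_measurable borel"
    by measurable
  have "integrable laguerre_measure (\<lambda>x. 2 * (cmod a)\<^sup>2 * (cmod (f x))\<^sup>2 + 2 * (cmod b)\<^sup>2 * (cmod (g x))\<^sup>2)"
    using laguerre_L2_D(2)[OF f] laguerre_L2_D(2)[OF g] by auto
  then show "integrable laguerre_measure (\<lambda>x. (cmod (a * f x + b * g x))\<^sup>2)"
  proof (rule Bochner_Integration.integrable_bound)
    show "AE x in laguerre_measure. norm ((cmod (a * f x + b * g x))\<^sup>2)
        \<le> norm (2 * (cmod a)\<^sup>2 * (cmod (f x))\<^sup>2 + 2 * (cmod b)\<^sup>2 * (cmod (g x))\<^sup>2)"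
    proof (rule AE_I2)
      fix x
      have "cmod (a * f x + b * g x) \<le> cmod (a * f x) + cmod (b * g x)"
        by (rule norm_triangle_ineq)
      then have "(cmod (a * f x + b * g x))\<^sup>2 \<le> (cmod (a * f x) + cmod (b * g x))\<^sup>2"
        by (intro power_mono) auto
      also have "\<dots> \<le> 2 * (cmod (a * f x))\<^sup>2 + 2 * (cmod (b * g x))\<^sup>2"
        using sum_squares_bound[of "cmod (a * f x)" "cmod (b * g x)"] by (simp add: power2_sum)
      finally show "norm ((cmod (a * f x + b * g x))\<^sup>2)
          \<le> norm (2 * (cmod a)\<^sup>2 * (cmod (f x))\<^sup>2 + 2 * (cmod b)\<^sup>2 * (cmod (g x))\<^sup>2)"
        by (simp add: norm_mult power_mult_distrib)
    qed
  qed measurable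
qed

lemma laguerre_L2_diff: "f \<in> laguerre_L2 \<Longrightarrow> g \<in> laguerre_L2 \<Longrightarrow> (\<lambda>x. f x - g x) \<in> laguerre_L2"
  using laguerre_L2_lincomb[of f g 1 "-1"] by simp

lemma zero_in_laguerre_L2: "(\<lambda>x. 0) \<in> laguerre_L2"
  by (rule laguerre_L2_I) auto

lemma laguerre_in_L2: "(\<lambda>x. of_real (laguerre n x)) \<in> laguerre_L2"
  using laguerre_orthonormal[of n n]
  by (intro laguerre_L2_I) (auto simp: power2_eq_square has_bochner_integral_iff)

text \<open>Both claims come from the pointwise inequality between arithmetic and geometric mean.
  The integrability obtained here is used to set up Cauchy-Schwarz for Bochner integrals.\<close>

lemma integrable_mult_laguerre_L2:
  assumes f: "f \<in> laguerre_L2" and g: "g \<in> laguerre_L2"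
  shows "integrable laguerre_measure (\<lambda>x. f x * g x)"
    and "(LINT x|laguerre_measure. cmod (f x * g x))
      \<le> ((LINT x|laguerre_measure. (cmod (f x))\<^sup>2) + (LINT x|laguerre_measure. (cmod (g x))\<^sup>2)) / 2"
proof -
  note [measurable] = laguerre_L2_D(1)[OF f] laguerre_L2_D(1)[OF g]
  have le: "cmod (f x * g x) \<le> ((cmod (f x))\<^sup>2 + (cmod (g x))\<^sup>2) / 2" for x
    using sum_squares_bound[of "cmod (f x)" "cmod (g x)"] by (simp add: norm_mult)
  have int: "integrable laguerre_measure (\<lambda>x. ((cmod (f x))\<^sup>2 + (cmod (g x))\<^sup>2) / 2)"
    using laguerre_L2_D(2)[OF f] laguerre_L2_D(2)[OF g] by auto
  then show fg: "integrable laguerre_measure (\<lambda>x. f x * g x)"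
    by (rule Bochner_Integration.integrable_bound) (measurable, rule AE_I2, rule order_trans[OF le], simp)
  have "(LINT x|laguerre_measure. cmod (f x * g x)) \<le> (LINT x|laguerre_measure. ((cmod (f x))\<^sup>2 + (cmod (g x))\<^sup>2) / 2)"
    by (intro integral_mono integrable_norm fg int le)
  also have "\<dots> = ((LINT x|laguerre_measure. (cmod (f x))\<^sup>2) + (LINT x|laguerre_measure. (cmod (g x))\<^sup>2)) / 2"
    using laguerre_L2_D(2)[OF f] laguerre_L2_D(2)[OF g] by simp
  finally show "(LINT x|laguerre_measure. cmod (f x * g x))
      \<le> ((LINT x|laguerre_measure. (cmod (f x))\<^sup>2) + (LINT x|laguerre_measure. (cmod (g x))\<^sup>2)) / 2" .
qed

lemma laguerre_Cauchy_Schwarz: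
  assumes f: "f \<in> laguerre_L2" and g: "g \<in> laguerre_L2"
  shows "(LINT x|laguerre_measure. cmod (f x * g x))
    \<le> sqrt (LINT x|laguerre_measure. (cmod (f x))\<^sup>2) * sqrt (LINT x|laguerre_measure. (cmod (g x))\<^sup>2)"
proof -
  note [measurable] = laguerre_L2_D(1)[OF f] laguerre_L2_D(1)[OF g]
  let ?A = "LINT x|laguerre_measure. (cmod (f x))\<^sup>2" and ?B = "LINT x|laguerre_measure. (cmod (g x))\<^sup>2"
    and ?C = "LINT x|laguerre_measure. cmod (f x * g x)"
  have nn: "0 \<le> ?A" "0 \<le> ?B" "0 \<le> ?C"
    by (auto intro: integral_nonneg_AE)
  have "(\<integral>\<^sup>+x. ennreal (cmod (f x)) * ennreal (cmod (g x)) \<partial>laguerre_measure)\<^sup>2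
      \<le> (\<integral>\<^sup>+x. ennreal (cmod (f x)) ^ 2 \<partial>laguerre_measure) * (\<integral>\<^sup>+x. ennreal (cmod (g x)) ^ 2 \<partial>laguerre_measure)"
    by (rule Cauchy_Schwarz_nn_integral) auto
  also have "(\<integral>\<^sup>+x. ennreal (cmod (f x)) * ennreal (cmod (g x)) \<partial>laguerre_measure) = ennreal ?C"
    by (subst nn_integral_eq_integral[symmetric])
      (auto simp: norm_mult ennreal_mult intro!: integrable_norm[of _ "\<lambda>x. f x * g x", unfolded norm_mult] integrable_mult_laguerre_L2 f g)
  also have "(\<integral>\<^sup>+x. ennreal (cmod (f x)) ^ 2 \<partial>laguerre_measure) = ennreal ?A"
    by (subst nn_integral_eq_integral[symmetric]) (auto simp: ennreal_power laguerre_L2_D f)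
  also have "(\<integral>\<^sup>+x. ennreal (cmod (g x)) ^ 2 \<partial>laguerre_measure) = ennreal ?B"
    by (subst nn_integral_eq_integral[symmetric]) (auto simp: ennreal_power laguerre_L2_D g)
  finally have "?C\<^sup>2 \<le> ?A * ?B"
    using nn by (simp add: ennreal_power flip: ennreal_mult)
  then have "sqrt (?C\<^sup>2) \<le> sqrt (?A * ?B)"
    by (rule real_sqrt_le_mono)
  then show ?thesis
    using nn by (simp add: real_sqrt_mult)
qed

text \<open>Cauchy-Schwarz against the constant 1, which is \<open>laguerre 0\<close> and has norm
  one.\<close>

lemma integral_cmod_le_L2_norm:
  assumes f: "f \<in> laguerre_L2"
  shows "integrable laguerre_measure f"
    and "(LINT x|laguerre_measure. cmod (f x)) \<le> sqrt (LINT x|laguerre_measure. (cmod (f x))\<^sup>2)"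
  using integrable_mult_laguerre_L2(1)[OF f laguerre_in_L2[of 0]] laguerre_Cauchy_Schwarz[OF f laguerre_in_L2[of 0]]
  by (simp_all add: laguerre_measure.prob_space[unfolded space_laguerre_measure])

section \<open>Laguerre coefficients, partial sums and Bessel's identity\<close>

definition laguerre_coeff :: "(real \<Rightarrow> complex) \<Rightarrow> nat \<Rightarrow> complex" where
  "laguerre_coeff f n = (LINT x|laguerre_measure. of_real (laguerre n x) * f x)"

definition laguerre_sum :: "(nat \<Rightarrow> complex) \<Rightarrow> nat \<Rightarrow> real \<Rightarrow> complex" where
  "laguerre_sum c N x = (\<Sum>n<N. c n * of_real (laguerre n x))"

lemma laguerre_coeff_lincomb:
  assumes "f \<in> laguerre_L2" "g \<in> laguerre_L2"
  shows "laguerre_coeff (\<lambda>x. a * f x + b * g x) n = a * laguerre_coeff f n + b * laguerre_coeff g n"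
proof -
  have "laguerre_coeff (\<lambda>x. a * f x + b * g x) n
      = (LINT x|laguerre_measure. a * (of_real (laguerre n x) * f x) + b * (of_real (laguerre n x) * g x))"
    unfolding laguerre_coeff_def by (simp add: algebra_simps)
  then show ?thesis
    using assms integrable_mult_laguerre_L2(1)[OF laguerre_in_L2] by (simp add: laguerre_coeff_def)
qed

lemma laguerre_coeff_diff:
  "f \<in> laguerre_L2 \<Longrightarrow> g \<in> laguerre_L2 \<Longrightarrow> laguerre_coeff (\<lambda>x. f x - g x) n = laguerre_coeff f n - laguerre_coeff g n"
  using laguerre_coeff_lincomb[of f g 1 "-1" n] by simp

lemma laguerre_sum_in_L2: "laguerre_sum c N \<in> laguerre_L2"
proof (induction N)
  case 0
  show ?case
    using zero_in_laguerre_L2 by (simp add: laguerre_sum_def[abs_def])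
next
  case (Suc N)
  then show ?case
    using laguerre_L2_lincomb[OF Suc laguerre_in_L2, of 1 "c N" N] by (simp add: laguerre_sum_def[abs_def])
qed

lemma laguerre_coeff_laguerre: "laguerre_coeff (\<lambda>x. of_real (laguerre m x)) n = (if m = n then 1 else 0)"
proof -
  have "laguerre_coeff (\<lambda>x. of_real (laguerre m x)) n = of_real (LINT x|laguerre_measure. laguerre n x * laguerre m x)"
    unfolding laguerre_coeff_def by (simp flip: integral_complex_of_real)
  then show ?thesis
    using laguerre_orthonormal[of n m] by (auto simp: has_bochner_integral_iff)
qed

lemma laguerre_coeff_sum: "laguerre_coeff (laguerre_sum c N) n = (if n < N then c n else 0)"
proof (induction N)
  case 0
  show ?case by (simp add: laguerre_sum_def[abs_def] laguerre_coeff_def)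
next
  case (Suc N)
  have "laguerre_sum c (Suc N) = (\<lambda>x. 1 * laguerre_sum c N x + c N * of_real (laguerre N x))"
    by (simp add: laguerre_sum_def[abs_def])
  then have "laguerre_coeff (laguerre_sum c (Suc N)) n
      = 1 * laguerre_coeff (laguerre_sum c N) n + c N * laguerre_coeff (\<lambda>x. of_real (laguerre N x)) n"
    by (simp only: laguerre_coeff_lincomb[OF laguerre_sum_in_L2 laguerre_in_L2])
  then show ?case
    using Suc by (cases "n = N") (auto simp: laguerre_coeff_laguerre)
qed

lemma norm_diff_laguerre:
  assumes f: "f \<in> laguerre_L2"
  shows "(LINT x|laguerre_measure. (cmod (f x - a * of_real (laguerre n x)))\<^sup>2)
    = (LINT x|laguerre_measure. (cmod (f x))\<^sup>2) - 2 * Re (cnj a * laguerre_coeff f n) + (cmod a)\<^sup>2"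
proof -
  define h where "h x = cnj a * (of_real (laguerre n x) * f x)" for x
  have expand: "(cmod (f x - a * of_real (laguerre n x)))\<^sup>2
      = (cmod (f x))\<^sup>2 - 2 * Re (h x) + (cmod a)\<^sup>2 * (laguerre n x * laguerre n x)" for x
    unfolding cmod_power2 h_def by (simp add: power2_eq_square algebra_simps)
  have int: "integrable laguerre_measure h"
    unfolding h_def by (intro integrable_mult_right integrable_mult_laguerre_L2 f laguerre_in_L2)
  have "(LINT x|laguerre_measure. Re (h x)) = Re (cnj a * laguerre_coeff f n)"
    unfolding integral_Re[OF int] unfolding h_def laguerre_coeff_def by simp
  then show ?thesis
    unfolding expand using laguerre_L2_D(2)[OF f] int laguerre_orthonormal[of n n]
    by (simp add: has_bochner_integral_iff)
qed

text \<open>Pythagoras, one basis vector at a time: subtracting the N-th term from the current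
  remainder lowers its squared norm by the squared modulus of the N-th coefficient.\<close>

lemma norm_diff_laguerre_sum:
  assumes f: "f \<in> laguerre_L2" and c: "\<And>n. n < N \<Longrightarrow> laguerre_coeff f n = c n"
  shows "(LINT x|laguerre_measure. (cmod (f x - laguerre_sum c N x))\<^sup>2)
    = (LINT x|laguerre_measure. (cmod (f x))\<^sup>2) - (\<Sum>n<N. (cmod (c n))\<^sup>2)"
  using c
proof (induction N)
  case 0
  show ?case by (simp add: laguerre_sum_def)
next
  case (Suc N)
  define g where "g x = f x - laguerre_sum c N x" for x
  have g: "g \<in> laguerre_L2"
    unfolding g_def by (intro laguerre_L2_diff f laguerre_sum_in_L2)
  \<comment> \<open>The terms already subtracted have index below N and do not affect the N-th
    coefficient.\<close>
  have coeff: "laguerre_coeff g N = c N"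
    unfolding g_def using Suc.prems by (simp add: laguerre_coeff_diff f laguerre_sum_in_L2 laguerre_coeff_sum)
  have "(LINT x|laguerre_measure. (cmod (f x - laguerre_sum c (Suc N) x))\<^sup>2)
      = (LINT x|laguerre_measure. (cmod (g x - c N * of_real (laguerre N x)))\<^sup>2)"
    by (simp add: g_def laguerre_sum_def algebra_simps)
  also have "\<dots> = (LINT x|laguerre_measure. (cmod (g x))\<^sup>2) - (cmod (c N))\<^sup>2"
  proof -
    have "Re (cnj (c N) * c N) = (cmod (c N))\<^sup>2"
      unfolding cmod_power2 by (simp add: power2_eq_square)
    then show ?thesis
      unfolding norm_diff_laguerre[OF g] coeff by linarith
  qed
  finally show ?case
    using Suc by (simp add: g_def)
qed

text \<open>Bessel's identity for the partial sum itself, whose remainder is 0.\<close>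

lemma norm_laguerre_sum:
  "(LINT x|laguerre_measure. (cmod (laguerre_sum c N x))\<^sup>2) = (\<Sum>n<N. (cmod (c n))\<^sup>2)"
  using norm_diff_laguerre_sum[OF laguerre_sum_in_L2, of N c N c] by (simp add: laguerre_coeff_sum)

lemma norm_laguerre_sum_diff:
  assumes "N \<le> M"
  shows "(LINT x|laguerre_measure. (cmod (laguerre_sum c M x - laguerre_sum c N x))\<^sup>2) = (\<Sum>n=N..<M. (cmod (c n))\<^sup>2)"
proof -
  have "(LINT x|laguerre_measure. (cmod (laguerre_sum c M x - laguerre_sum c N x))\<^sup>2)
      = (\<Sum>n<M. (cmod (c n))\<^sup>2) - (\<Sum>n<N. (cmod (c n))\<^sup>2)"
    by (subst norm_diff_laguerre_sum[OF laguerre_sum_in_L2])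
      (use assms in \<open>simp_all add: laguerre_coeff_sum norm_laguerre_sum\<close>)
  moreover have "(\<Sum>n<N. (cmod (c n))\<^sup>2) + (\<Sum>n=N..<M. (cmod (c n))\<^sup>2) = (\<Sum>n<M. (cmod (c n))\<^sup>2)"
    unfolding lessThan_atLeast0 using assms by (intro sum.atLeastLessThan_concat) auto
  ultimately show ?thesis
    by linarith
qed

section \<open>Termwise integration and completeness\<close>

text \<open>The L^1 norms of L_n f are bounded uniformly in n, so absolute summability of b controls
  the interchange of sum and integral. It serves both the exponentials in the completeness proof and
  the Bargmann kernel.\<close>

lemma laguerre_expansion_integral:
  assumes f: "f \<in> laguerre_L2" and b: "summable (\<lambda>n. cmod (b n))"
    and bx: "\<And>x. summable (\<lambda>n. cmod (b n * of_real (laguerre n x)))"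
  shows "integrable laguerre_measure (\<lambda>x. (\<Sum>n. b n * of_real (laguerre n x)) * f x)"
    and "(\<lambda>n. b n * laguerre_coeff f n) sums
      (LINT x|laguerre_measure. (\<Sum>n. b n * of_real (laguerre n x)) * f x)"
proof -
  define F where "F n x = b n * (of_real (laguerre n x) * f x)" for n x
  let ?C = "(1 + (LINT x|laguerre_measure. (cmod (f x))\<^sup>2)) / 2"
  have int: "integrable laguerre_measure (F n)" for n
    unfolding F_def by (intro integrable_mult_right integrable_mult_laguerre_L2 f laguerre_in_L2)
  have "(LINT x|laguerre_measure. cmod (of_real (laguerre n x) * f x)) \<le> ?C" for n
    using integrable_mult_laguerre_L2(2)[OF laguerre_in_L2 f, of n] laguerre_orthonormal[of n n]
    by (simp add: power2_eq_square has_bochner_integral_iff)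
  then have le: "(LINT x|laguerre_measure. cmod (F n x)) \<le> cmod (b n) * ?C" for n
    unfolding F_def norm_mult[of "b n"] by (simp add: mult_left_mono del: times_divide_eq_right)
  have 1: "AE x in laguerre_measure. summable (\<lambda>n. cmod (F n x))"
  proof (rule AE_I2)
    fix x
    show "summable (\<lambda>n. cmod (F n x))"
      using summable_mult2[OF bx[of x], of "cmod (f x)"] by (simp add: F_def norm_mult mult.assoc)
  qed
  have 2: "summable (\<lambda>n. LINT x|laguerre_measure. cmod (F n x))"
  proof (rule summable_comparison_test')
    show "summable (\<lambda>n. cmod (b n) * ?C)"
      by (intro summable_mult2 b)
    show "norm (LINT x|laguerre_measure. cmod (F n x)) \<le> cmod (b n) * ?C" if "n \<ge> 0" for n
      using le[of n] by (simp add: integral_nonneg_AE)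
  qed
  have F_sum: "(\<Sum>n. F n x) = (\<Sum>n. b n * of_real (laguerre n x)) * f x" for x
    using suminf_mult2[OF summable_norm_cancel[OF bx[of x]], of "f x"] by (simp add: F_def mult.assoc)
  show "integrable laguerre_measure (\<lambda>x. (\<Sum>n. b n * of_real (laguerre n x)) * f x)"
    using integrable_suminf[OF int 1 2] by (simp only: F_sum)
  have "(LINT x|laguerre_measure. F n x) = b n * laguerre_coeff f n" for n
    by (simp add: F_def laguerre_coeff_def)
  then show "(\<lambda>n. b n * laguerre_coeff f n) sums
      (LINT x|laguerre_measure. (\<Sum>n. b n * of_real (laguerre n x)) * f x)"
    using sums_integral[OF int 1 2] by (simp only: F_sum)
qed

text \<open>Evaluate the generating function at \<open>w = k / (k + 1)\<close>, where it is a multiple of \<open>exp (- k x)\<close>.\<close>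

lemma exp_moments_zero:
  assumes f: "f \<in> laguerre_L2" and z: "\<And>n. laguerre_coeff f n = 0"
  shows "(LINT x|laguerre_measure. of_real (exp (- x) ^ k) * f x) = 0"
proof -
  define w :: complex where "w = of_real (real k / (real k + 1))"
  have w: "cmod w < 1"
    unfolding w_def norm_of_real by simp
  have "1 - real k / (real k + 1) = 1 / real (k + 1)"
    by (simp add: field_simps)
  moreover have "1 - w = of_real (1 - real k / (real k + 1))"
    by (simp add: w_def)
  ultimately have w1: "1 - w = 1 / of_nat (k + 1)"
    by simp
  have "w / (1 - w) = of_real (real k / (real k + 1) / (1 / real (k + 1)))"
    unfolding w1 unfolding w_def by simp
  also have "real k / (real k + 1) / (1 / real (k + 1)) = real k"
    by (simp add: add.commute)
  finally have "w / (1 - w) = of_nat k"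
    by simp
  then have e: "- of_real x * w / (1 - w) = of_real (- (real k * x))" for x
    by (metis mult.commute of_real_minus of_real_mult of_real_of_nat_eq times_divide_eq_right mult_minus_left)
  have gen: "(\<Sum>n. w ^ n * of_real (laguerre n x)) = of_nat (k + 1) * of_real (exp (- x) ^ k)" for x
  proof -
    have "(\<Sum>n. w ^ n * of_real (laguerre n x)) = exp (of_real (- (real k * x))) / (1 / of_nat (k + 1))"
      using sums_unique[OF laguerre_generating_function(2)[OF w, of x]] unfolding e unfolding w1
      by (simp add: mult.commute)
    then show ?thesis
      by (simp flip: exp_of_nat_mult exp_of_real of_real_power)
  qed
  have "(\<lambda>n. w ^ n * laguerre_coeff f n) sums
      (LINT x|laguerre_measure. (\<Sum>n. w ^ n * of_real (laguerre n x)) * f x)"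
  proof (rule laguerre_expansion_integral[OF f])
    show "summable (\<lambda>n. cmod (w ^ n))"
      using w by (simp add: norm_power)
    show "summable (\<lambda>n. cmod (w ^ n * of_real (laguerre n x)))" for x
      using laguerre_generating_function(1)[OF w, of x] by (simp add: mult.commute)
  qed
  then have "(LINT x|laguerre_measure. of_nat (k + 1) * (of_real (exp (- x) ^ k) * f x)) = 0"
    unfolding gen z by (simp add: sums_iff mult.assoc)
  then have "of_nat (k + 1) * (LINT x|laguerre_measure. of_real (exp (- x) ^ k) * f x) = 0"
    by (simp only: integral_mult_right_zero)
  then show ?thesis
    by (simp del: of_nat_Suc of_nat_add)
qed

lemma AE_laguerre_measure_nonneg: "AE x in laguerre_measure. 0 \<le> x"
  unfolding laguerre_measure_def by (subst AE_density) (auto simp: indicator_def)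

lemma integrable_bounded_mult_laguerre_L2:
  assumes f: "f \<in> laguerre_L2" and [measurable]: "g \<in> borel_measurable borel"
    and g: "\<And>x. 0 \<le> x \<Longrightarrow> \<bar>g x\<bar> \<le> C"
  shows "integrable laguerre_measure (\<lambda>x. of_real (g x) * f x)"
proof (rule Bochner_Integration.integrable_bound)
  note [measurable] = laguerre_L2_D(1)[OF f]
  show "integrable laguerre_measure (\<lambda>x. C * cmod (f x))"
    by (intro integrable_mult_right integrable_norm integral_cmod_le_L2_norm f)
  show "AE x in laguerre_measure. norm (of_real (g x) * f x) \<le> norm (C * cmod (f x))"
    using AE_laguerre_measure_nonneg
  proof eventually_elim
    case (elim x)
    then have "\<bar>g x\<bar> * cmod (f x) \<le> C * cmod (f x)"
      by (intro mult_right_mono g) auto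
    then show ?case
      by (simp add: norm_mult)
  qed
  show "(\<lambda>x. of_real (g x) * f x) \<in> borel_measurable laguerre_measure"
    by measurable
qed

text \<open>The measure lives on x \<ge> 0, where exp(-x) stays in [0, 1]. A polynomial within e of
  h on that interval contributes 0, so the integral is at most e times the L^1 norm of f.\<close>

lemma integral_continuous_exp_zero:
  assumes f: "f \<in> laguerre_L2" and z: "\<And>n. laguerre_coeff f n = 0"
    and h: "continuous_on UNIV h"
  shows "(LINT x|laguerre_measure. of_real (h (exp (- x))) * f x) = 0"
proof -
  note [measurable] = laguerre_L2_D(1)[OF f]
  define I where "I = (LINT x|laguerre_measure. of_real (h (exp (- x))) * f x)"
  define A where "A = (LINT x|laguerre_measure. cmod (f x))"
  have "compact (h ` {0..1})"
    by (intro compact_continuous_image continuous_on_subset[OF h]) auto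
  then obtain C where C: "\<And>u. u \<in> {0..1} \<Longrightarrow> \<bar>h u\<bar> \<le> C"
    using compact_imp_bounded bounded_iff by (metis imageI real_norm_def)
  have [measurable]: "h \<in> borel_measurable borel"
    using h by (rule borel_measurable_continuous_onI)
  have int_h: "integrable laguerre_measure (\<lambda>x. of_real (h (exp (- x))) * f x)"
    using C by (intro integrable_bounded_mult_laguerre_L2[OF f, where C = C]) auto
  have le: "cmod I \<le> e * A" if "e > 0" for e
  proof -
    obtain g where g: "real_polynomial_function g" "\<And>u. u \<in> {0..1} \<Longrightarrow> \<bar>h u - g u\<bar> < e"
      using Stone_Weierstrass_real_polynomial_function[OF compact_Icc continuous_on_subset[OF h subset_UNIV] \<open>e > 0\<close>]
      by blast
    then obtain a n where a: "g = (\<lambda>u. \<Sum>i\<le>n. a i * u ^ i)"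
      using real_polynomial_function_iff_sum by blast
    have pow: "integrable laguerre_measure (\<lambda>x. of_real (exp (- x) ^ i) * f x)" for i
      by (intro integrable_bounded_mult_laguerre_L2[OF f, where C = 1]) (auto simp: power_le_one)
    have g_eq: "of_real (g (exp (- x))) * f x = (\<Sum>i\<le>n. of_real (a i) * (of_real (exp (- x) ^ i) * f x))" for x
      by (simp add: a sum_distrib_right mult.assoc)
    have int_g: "integrable laguerre_measure (\<lambda>x. of_real (g (exp (- x))) * f x)"
      unfolding g_eq by (intro Bochner_Integration.integrable_sum integrable_mult_right pow)
    have "(LINT x|laguerre_measure. of_real (g (exp (- x))) * f x)
        = (\<Sum>i\<le>n. LINT x|laguerre_measure. of_real (a i) * (of_real (exp (- x) ^ i) * f x))"
      unfolding g_eq by (intro Bochner_Integration.integral_sum integrable_mult_right pow)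
    also have "\<dots> = 0"
      by (simp only: integral_mult_right_zero exp_moments_zero[OF f z] mult_zero_right sum.neutral_const)
    finally have "I = (LINT x|laguerre_measure. of_real (h (exp (- x))) * f x - of_real (g (exp (- x))) * f x)"
      unfolding I_def using int_h int_g by simp
    also have "cmod \<dots> \<le> (LINT x|laguerre_measure. e * cmod (f x))"
    proof (rule order_trans[OF integral_norm_bound integral_mono_AE])
      show "integrable laguerre_measure (\<lambda>x. norm (of_real (h (exp (- x))) * f x - of_real (g (exp (- x))) * f x))"
        by (intro integrable_norm Bochner_Integration.integrable_diff int_h int_g)
      show "integrable laguerre_measure (\<lambda>x. e * cmod (f x))"
        by (intro integrable_mult_right integrable_norm integral_cmod_le_L2_norm f)
      show "AE x in laguerre_measure. norm (of_real (h (exp (- x))) * f x - of_real (g (exp (- x))) * f x) \<le> e * cmod (f x)"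
        using AE_laguerre_measure_nonneg
      proof eventually_elim
        case (elim x)
        have "norm (of_real (h (exp (- x))) * f x - of_real (g (exp (- x))) * f x) = \<bar>h (exp (- x)) - g (exp (- x))\<bar> * cmod (f x)"
          by (simp only: left_diff_distrib[symmetric] of_real_diff[symmetric] norm_mult norm_of_real)
        also have "\<dots> \<le> e * cmod (f x)"
          using g(2)[of "exp (- x)"] elim by (intro mult_right_mono[OF less_imp_le]) auto
        finally show ?case .
      qed
    qed
    finally show ?thesis
      by (simp add: A_def)
  qed
  have "A \<ge> 0"
    unfolding A_def by (intro integral_nonneg_AE) auto
  have "cmod I \<le> 0"
  proof (rule field_le_epsilon)
    fix e :: real assume "e > 0"
    \<comment> \<open>Dividing by A + 1 instead of A covers the case A = 0.\<close>
    then have "cmod I \<le> e / (A + 1) * A"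
      using \<open>A \<ge> 0\<close> by (intro le) auto
    also have "\<dots> \<le> e"
      using \<open>A \<ge> 0\<close> \<open>e > 0\<close> by (simp add: field_simps)
    finally show "cmod I \<le> 0 + e"
      by simp
  qed
  then show ?thesis
    by (simp add: I_def)
qed

lemma integral_lessThan_zero:
  assumes f: "f \<in> laguerre_L2" and z: "\<And>n. laguerre_coeff f n = 0"
  shows "(LINT x:{..<a}|laguerre_measure. f x) = 0"
proof -
  note [measurable] = laguerre_L2_D(1)[OF f]
  \<comment> \<open>A continuous ramp in u = exp(-x): for j > 0 it is 0 up to exp(-a) and 1 from
    exp(-a) + 1/j on. It tends to the indicator of u > exp(-a), that is, of x < a.\<close>
  define h where "h j u = max 0 (min 1 (real j * (u - exp (- a))))" for j u
  have h: "continuous_on UNIV (h j)" for j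
    unfolding h_def by (intro continuous_intros)
  have [measurable]: "h j \<in> borel_measurable borel" for j
    using h by (rule borel_measurable_continuous_onI)
  have "(\<lambda>j. LINT x|laguerre_measure. of_real (h j (exp (- x))) * f x) \<longlonglongrightarrow> (LINT x|laguerre_measure. indicator {..<a} x *\<^sub>R f x)"
  proof (rule integral_dominated_convergence[where w = "\<lambda>x. cmod (f x)"])
    show "integrable laguerre_measure (\<lambda>x. cmod (f x))"
      by (intro integrable_norm integral_cmod_le_L2_norm f)
    show "AE x in laguerre_measure. norm (of_real (h j (exp (- x))) * f x) \<le> cmod (f x)" for j
      by (rule AE_I2) (auto simp: norm_mult h_def intro!: mult_left_le_one_le)
    show "AE x in laguerre_measure. (\<lambda>j. of_real (h j (exp (- x))) * f x) \<longlonglongrightarrow> indicator {..<a} x *\<^sub>R f x"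
    proof (rule AE_I2)
      fix x
      have "(\<lambda>j. h j (exp (- x))) \<longlonglongrightarrow> indicator {..<a} x"
      proof (cases "x < a")
        case True
        define d where "d = exp (- x) - exp (- a)"
        have "d > 0"
          using True by (simp add: d_def)
        obtain J :: nat where J: "1 / d \<le> real J"
          using real_arch_simple by blast
        have "h j (exp (- x)) = 1" if "j \<ge> J" for j
        proof -
          have "1 \<le> real J * d"
            using J \<open>d > 0\<close> by (simp add: field_simps)
          also have "\<dots> \<le> real j * d"
            using that \<open>d > 0\<close> by (intro mult_right_mono) auto
          finally show ?thesis
            by (simp add: h_def d_def)
        qed
        then have "\<forall>\<^sub>F j in sequentially. h j (exp (- x)) = 1"
          unfolding eventually_sequentially by blast
        then show ?thesis
          using True by (simp add: tendsto_eventually)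
      next
        case False
        then have "real j * (exp (- x) - exp (- a)) \<le> 0" for j
          by (intro mult_nonneg_nonpos) auto
        then have "h j (exp (- x)) = 0" for j
          unfolding h_def by (intro max_absorb1 min.coboundedI2)
        with False show ?thesis
          by simp
      qed
      then show "(\<lambda>j. of_real (h j (exp (- x))) * f x) \<longlonglongrightarrow> indicator {..<a} x *\<^sub>R f x"
        unfolding scaleR_conv_of_real by (intro tendsto_mult tendsto_of_real tendsto_const)
    qed
  qed measurable
  moreover have "(LINT x|laguerre_measure. of_real (h j (exp (- x))) * f x) = 0" for j
    by (rule integral_continuous_exp_zero[OF f z h])
  ultimately show ?thesis
    by (simp add: set_lebesgue_integral_def LIMSEQ_const_iff)
qed

text \<open>The sets over which f integrates to 0 contain the open left half-lines and are closed
  under complements and disjoint unions, so they are all Borel sets.\<close>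

lemma laguerre_complete:
  assumes f: "f \<in> laguerre_L2" and z: "\<And>n. laguerre_coeff f n = 0"
  shows "AE x in laguerre_measure. f x = 0"
proof (rule laguerre_measure.density_zero)
  show int: "integrable laguerre_measure f"
    by (rule integral_cmod_le_L2_norm[OF f])
  \<comment> \<open>The moment with exponent 0; it is needed for complements.\<close>
  have total: "(LINT x|laguerre_measure. f x) = 0"
    using exp_moments_zero[OF f z, of 0] by simp
  have set_int: "set_integrable laguerre_measure A f" if "A \<in> sets borel" for A
    unfolding set_integrable_def using that by (intro integrable_mult_indicator int) auto
  fix A assume "A \<in> sets laguerre_measure"
  then have "A \<in> sigma_sets UNIV (range lessThan)"
    by (simp add: borel_Iio)
  then show "set_lebesgue_integral laguerre_measure A f = 0"
  proof (rule sigma_sets_induct_disjoint[rotated 2])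
    show "Int_stable (range lessThan :: real set set)"
    proof -
      have "{..<a} \<inter> {..<b} = {..<min a b}" for a b :: real
        by auto
      then show ?thesis
        by (auto simp: Int_stable_def)
    qed
    show "set_lebesgue_integral laguerre_measure B f = 0" if "B \<in> range lessThan" for B
      using that integral_lessThan_zero[OF f z] by auto
    show "set_lebesgue_integral laguerre_measure (UNIV - B) f = 0"
      if "B \<in> sigma_sets UNIV (range lessThan)" "set_lebesgue_integral laguerre_measure B f = 0" for B
    proof -
      have B: "B \<in> sets borel"
        using that(1) by (simp add: borel_Iio)
      have "set_lebesgue_integral laguerre_measure (B \<union> (UNIV - B)) f
          = set_lebesgue_integral laguerre_measure B f + set_lebesgue_integral laguerre_measure (UNIV - B) f"
        using B by (intro set_integral_Un set_int) auto
      then show ?thesis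
        using that(2) total by (simp add: set_lebesgue_integral_def)
    qed
    show "set_lebesgue_integral laguerre_measure (\<Union>i. B i) f = 0"
      if "disjoint_family B" "range B \<subseteq> sigma_sets UNIV (range lessThan)"
        "\<And>i. set_lebesgue_integral laguerre_measure (B i) f = 0" for B :: "nat \<Rightarrow> real set"
    proof -
      have B: "B i \<in> sets borel" for i
        using that(2) by (auto simp: borel_Iio)
      have "set_lebesgue_integral laguerre_measure (\<Union>i. B i) f = (\<Sum>i. set_lebesgue_integral laguerre_measure (B i) f)"
        using B that(1) by (intro lebesgue_integral_countable_add set_int) (auto simp: disjoint_family_on_def)
      then show ?thesis
        by (simp add: that(3))
    qed
  qed (auto simp: set_lebesgue_integral_def)
qed

section \<open>Riesz-Fischer and Parseval\<close>

text \<open>The partial sums are Cauchy in L^2. A subsequence converges almost everywhere, and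
  Fatou's lemma turns its pointwise limit into the L^2 limit of the whole sequence.\<close>

lemma laguerre_Riesz_Fischer:
  assumes c: "summable (\<lambda>n. (cmod (c n))\<^sup>2)"
  obtains f where "f \<in> laguerre_L2" "\<And>n. laguerre_coeff f n = c n"
    "(\<lambda>N. LINT x|laguerre_measure. (cmod (f x - laguerre_sum c N x))\<^sup>2) \<longlonglongrightarrow> 0"
proof -
  define S where "S = laguerre_sum c"
  have S: "S N \<in> laguerre_L2" for N
    by (simp add: S_def laguerre_sum_in_L2)
  note [measurable] = laguerre_L2_D(1)[OF S]
  define T where "T N = (\<Sum>n. (cmod (c (n + N)))\<^sup>2)" for N
  have T_lim: "T \<longlonglongrightarrow> 0"
    unfolding T_def by (rule suminf_exist_split2[OF c])
  have diff_le: "(LINT x|laguerre_measure. (cmod (S M x - S N x))\<^sup>2) \<le> T N" if "N \<le> M" for M N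
  proof -
    have "(\<Sum>n=N..<M. (cmod (c n))\<^sup>2) = (\<Sum>n<M - N. (cmod (c (n + N)))\<^sup>2)"
      using that by (intro sum.reindex_bij_witness[of _ "\<lambda>n. n + N" "\<lambda>n. n - N"]) auto
    also have "\<dots> \<le> T N"
      unfolding T_def by (intro sum_le_suminf summable_ignore_initial_segment c) auto
    finally show ?thesis
      unfolding S_def norm_laguerre_sum_diff[OF that] .
  qed
  \<comment> \<open>The theorem on subsequences converging almost everywhere works with L^1
    distances, which the L^2 distances dominate because the measure has mass one.\<close>
  have L1: "(LINT x|laguerre_measure. cmod (S M x - S N x)) \<le> sqrt (T N)" if "N \<le> M" for M N
    using integral_cmod_le_L2_norm(2)[OF laguerre_L2_diff[OF S S], of M N] diff_le[OF that]
    by (meson order_trans real_sqrt_le_mono)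
  have sqrtT: "(\<lambda>N. sqrt (T N)) \<longlonglongrightarrow> 0"
    using tendsto_real_sqrt[OF T_lim] by simp
  obtain r where r: "strict_mono r" "AE x in laguerre_measure. Cauchy (\<lambda>i. S (r i) x)"
  proof (rule cauchy_L1_AE_cauchy_subseq[of laguerre_measure S])
    show "integrable laguerre_measure (S n)" for n
      by (rule integral_cmod_le_L2_norm[OF S])
    fix e :: real assume "e > 0"
    then obtain N where N: "\<And>n. n \<ge> N \<Longrightarrow> sqrt (T n) < e"
      using order_tendstoD(2)[OF sqrtT] by (auto simp: eventually_sequentially)
    have "(LINT x|laguerre_measure. cmod (S i x - S j x)) < e" if "i \<ge> N" "j \<ge> N" for i j
    proof (cases "j \<le> i")
      case True
      then show ?thesis using L1[OF True] N[OF that(2)] by simp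
    next
      case False
      then show ?thesis using L1[of i j] N[OF that(1)] by (simp add: norm_minus_commute)
    qed
    then show "\<exists>N. \<forall>i\<ge>N. \<forall>j\<ge>N. (LINT x|laguerre_measure. norm (S i x - S j x)) < e"
      by blast
  qed
  define f where "f x = lim (\<lambda>i. S (r i) x)" for x
  have [measurable]: "f \<in> borel_measurable borel"
    unfolding f_def by measurable
  have f_lim: "AE x in laguerre_measure. (\<lambda>i. S (r i) x) \<longlonglongrightarrow> f x"
    using r(2) by eventually_elim (simp add: f_def Cauchy_convergent_iff convergent_LIMSEQ_iff)
  \<comment> \<open>Fatou along the subsequence: once \<open>r i\<close> is at least N, the squared
    distance from \<open>S (r i)\<close> to \<open>S N\<close> is at most the tail
    \<open>T N\<close>.\<close>
  have nn: "(\<integral>\<^sup>+x. ennreal ((cmod (f x - S N x))\<^sup>2) \<partial>laguerre_measure) \<le> ennreal (T N)" for N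
  proof -
    have "(\<integral>\<^sup>+x. ennreal ((cmod (f x - S N x))\<^sup>2) \<partial>laguerre_measure)
        = (\<integral>\<^sup>+x. liminf (\<lambda>i. ennreal ((cmod (S (r i) x - S N x))\<^sup>2)) \<partial>laguerre_measure)"
    proof (rule nn_integral_cong_AE)
      show "AE x in laguerre_measure. ennreal ((cmod (f x - S N x))\<^sup>2) = liminf (\<lambda>i. ennreal ((cmod (S (r i) x - S N x))\<^sup>2))"
        using f_lim
      proof eventually_elim
        case (elim x)
        then have "(\<lambda>i. ennreal ((cmod (S (r i) x - S N x))\<^sup>2)) \<longlonglongrightarrow> ennreal ((cmod (f x - S N x))\<^sup>2)"
          by (intro tendsto_ennrealI tendsto_intros)
        then show ?case
          by (rule lim_imp_Liminf[OF trivial_limit_sequentially, symmetric])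
      qed
    qed
    also have "\<dots> \<le> liminf (\<lambda>i. \<integral>\<^sup>+x. ennreal ((cmod (S (r i) x - S N x))\<^sup>2) \<partial>laguerre_measure)"
      by (rule nn_integral_liminf) measurable
    also have "\<dots> \<le> ennreal (T N)"
    proof (rule Liminf_le)
      show "\<forall>\<^sub>F i in sequentially. (\<integral>\<^sup>+x. ennreal ((cmod (S (r i) x - S N x))\<^sup>2) \<partial>laguerre_measure) \<le> ennreal (T N)"
        using eventually_ge_at_top[of N]
      proof eventually_elim
        case (elim i)
        then have "N \<le> r i"
          using seq_suble[OF r(1), of i] by simp
        moreover have "(\<integral>\<^sup>+x. ennreal ((cmod (S (r i) x - S N x))\<^sup>2) \<partial>laguerre_measure)
            = ennreal (LINT x|laguerre_measure. (cmod (S (r i) x - S N x))\<^sup>2)"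
          by (intro nn_integral_eq_integral laguerre_L2_D(2)[OF laguerre_L2_diff[OF S S]]) auto
        ultimately show ?case
          by (simp add: diff_le ennreal_leI)
      qed
    qed simp
    finally show ?thesis .
  qed
  have int: "integrable laguerre_measure (\<lambda>x. (cmod (f x - S N x))\<^sup>2)" for N
    using nn[of N] by (intro integrableI_bounded) (auto simp: le_less_trans)
  \<comment> \<open>\<open>S 0\<close> is the empty sum, so the bound for N = 0 concerns f
    itself.\<close>
  have f: "f \<in> laguerre_L2"
    using int[of 0] by (intro laguerre_L2_I) (auto simp: S_def laguerre_sum_def)
  have T_nonneg: "0 \<le> T N" for N
    unfolding T_def by (intro suminf_nonneg summable_ignore_initial_segment c) auto
  have le_T: "(LINT x|laguerre_measure. (cmod (f x - S N x))\<^sup>2) \<le> T N" for N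
    using nn[of N] T_nonneg[of N] by (subst (asm) nn_integral_eq_integral[OF int]) auto
  have lim: "(\<lambda>N. LINT x|laguerre_measure. (cmod (f x - S N x))\<^sup>2) \<longlonglongrightarrow> 0"
    by (rule tendsto_sandwich[OF _ _ tendsto_const T_lim]) (auto simp: le_T integral_nonneg_AE)
  have "laguerre_coeff f n = c n" for n
  proof -
    define d where "d = cmod (laguerre_coeff f n - c n)"
    \<comment> \<open>For N > n the N-th partial sum already has coefficient c n, so the error is a
      coefficient of the remainder and is bounded by its norm.\<close>
    have le: "d \<le> sqrt (T N)" if "n < N" for N
    proof -
      have g: "(\<lambda>x. f x - S N x) \<in> laguerre_L2"
        by (intro laguerre_L2_diff f S)
      have "laguerre_coeff f n - c n = laguerre_coeff (\<lambda>x. f x - S N x) n"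
        using that by (simp add: laguerre_coeff_diff f S) (simp add: S_def laguerre_coeff_sum)
      then have "d \<le> (LINT x|laguerre_measure. cmod (of_real (laguerre n x) * (f x - S N x)))"
        unfolding d_def laguerre_coeff_def by (simp only: integral_norm_bound)
      also have "\<dots> \<le> sqrt (LINT x|laguerre_measure. (cmod (of_real (laguerre n x)))\<^sup>2)
          * sqrt (LINT x|laguerre_measure. (cmod (f x - S N x))\<^sup>2)"
        by (rule laguerre_Cauchy_Schwarz[OF laguerre_in_L2 g])
      also have "\<dots> = sqrt (LINT x|laguerre_measure. (cmod (f x - S N x))\<^sup>2)"
        using laguerre_orthonormal[of n n] by (simp add: power2_eq_square has_bochner_integral_iff)
      also have "\<dots> \<le> sqrt (T N)"
        by (intro real_sqrt_le_mono le_T)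
      finally show ?thesis .
    qed
    have "d \<le> 0"
      by (rule tendsto_lowerbound[OF sqrtT]) (use le in \<open>auto intro: eventually_mono[OF eventually_gt_at_top[of n]]\<close>)
    then show ?thesis
      by (simp add: d_def)
  qed
  then show thesis
    using f lim that unfolding S_def by blast
qed

text \<open>Bessel's inequality makes the coefficients square summable. Riesz-Fischer supplies a
  function with these coefficients that is the limit of its expansion, and completeness identifies
  it with f almost everywhere.\<close>

lemma laguerre_Parseval:
  assumes f: "f \<in> laguerre_L2"
  shows "(\<lambda>n. (cmod (laguerre_coeff f n))\<^sup>2) sums (LINT x|laguerre_measure. (cmod (f x))\<^sup>2)"
proof -
  define c where "c = laguerre_coeff f"
  have diff: "(LINT x|laguerre_measure. (cmod (f x - laguerre_sum c N x))\<^sup>2)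
      = (LINT x|laguerre_measure. (cmod (f x))\<^sup>2) - (\<Sum>n<N. (cmod (c n))\<^sup>2)" for N
    by (rule norm_diff_laguerre_sum[OF f]) (simp add: c_def)
  have "(\<Sum>n<N. (cmod (c n))\<^sup>2) \<le> (LINT x|laguerre_measure. (cmod (f x))\<^sup>2)" for N
  proof -
    have "0 \<le> (LINT x|laguerre_measure. (cmod (f x - laguerre_sum c N x))\<^sup>2)"
      by (intro integral_nonneg_AE) auto
    then show ?thesis
      unfolding diff by simp
  qed
  then have "summable (\<lambda>n. (cmod (c n))\<^sup>2)"
    by (intro summableI_nonneg_bounded) auto
  then obtain g where g: "g \<in> laguerre_L2" "\<And>n. laguerre_coeff g n = c n"
    and lim: "(\<lambda>N. LINT x|laguerre_measure. (cmod (g x - laguerre_sum c N x))\<^sup>2) \<longlonglongrightarrow> 0"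
    using laguerre_Riesz_Fischer by blast
  have "AE x in laguerre_measure. f x - g x = 0"
    by (intro laguerre_complete laguerre_L2_diff f g) (simp add: laguerre_coeff_diff f g c_def)
  note fg = this
  note [measurable] = laguerre_L2_D(1)[OF f] laguerre_L2_D(1)[OF g(1)] laguerre_L2_D(1)[OF laguerre_sum_in_L2]
  have "(LINT x|laguerre_measure. (cmod (g x - laguerre_sum c N x))\<^sup>2)
      = (LINT x|laguerre_measure. (cmod (f x - laguerre_sum c N x))\<^sup>2)" for N
    by (rule integral_cong_AE) (measurable, use fg in \<open>auto elim!: eventually_mono\<close>)
  then have "(\<lambda>N. (LINT x|laguerre_measure. (cmod (f x))\<^sup>2) - (\<Sum>n<N. (cmod (c n))\<^sup>2)) \<longlonglongrightarrow> 0"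
    using lim by (simp add: diff)
  then have "(\<lambda>N. \<Sum>n<N. (cmod (c n))\<^sup>2) \<longlonglongrightarrow> (LINT x|laguerre_measure. (cmod (f x))\<^sup>2)"
    using tendsto_diff[OF tendsto_const[of "LINT x|laguerre_measure. (cmod (f x))\<^sup>2"]] by fastforce
  then show ?thesis
    by (simp add: sums_def c_def)
qed

section \<open>The kernel\<close>

text \<open>Euler's integral for Gamma(3/2), rescaled by c: the measure gives a factor 1/c and the
  square root a factor 1/sqrt c.\<close>

lemma has_bochner_integral_sqrt_exp:
  assumes c: "c > 0"
  shows "has_bochner_integral lborel (\<lambda>t. indicator {0..} t * (sqrt t * exp (- (c * t)))) (Gamma (3 / 2) / (c * sqrt c))"
proof -
  have powr_half: "t powr (3 / 2 - 1) / exp t = sqrt t * exp (- t)" if "t \<ge> 0" for t :: real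
    using that powr_half_sqrt[of t] by (simp add: exp_minus field_simps)
  have "((\<lambda>t::real. t powr (3 / 2 - 1) / exp t) has_integral Gamma (3 / 2)) {0..}"
    by (rule Gamma_integral_real) simp
  then have "((\<lambda>t::real. sqrt t * exp (- t)) has_integral Gamma (3 / 2)) {0..}"
    by (rule has_integral_eq[rotated]) (rule powr_half, simp)
  then have "(\<integral>\<^sup>+t. ennreal (indicator {0..} t * (sqrt t * exp (- t))) \<partial>lborel) = ennreal (Gamma (3 / 2))"
    by (intro nn_integral_has_integral_lebesgue) auto
  then have 1: "has_bochner_integral lborel (\<lambda>t::real. indicator {0..} t * (sqrt t * exp (- t))) (Gamma (3 / 2))"
    by (intro has_bochner_integral_nn_integral) (auto simp: indicator_def Gamma_real_pos intro: less_imp_le)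
  have "has_bochner_integral lborel (\<lambda>t. indicator {0..} (0 + c * t) * (sqrt (0 + c * t) * exp (- (0 + c * t)))) (Gamma (3 / 2) /\<^sub>R \<bar>c\<bar>)"
    using lborel_has_bochner_integral_real_affine_iff[of c "\<lambda>t. indicator {0..} t * (sqrt t * exp (- t))" "Gamma (3 / 2)" 0] 1 c
    by simp
  then have "has_bochner_integral lborel (\<lambda>t. indicator {0..} (0 + c * t) * (sqrt (0 + c * t) * exp (- (0 + c * t))) / sqrt c) (Gamma (3 / 2) /\<^sub>R \<bar>c\<bar> / sqrt c)"
    by (rule has_bochner_integral_divide_zero)
  also have "(\<lambda>t. indicator {0..} (0 + c * t) * (sqrt (0 + c * t) * exp (- (0 + c * t))) / sqrt c)
      = (\<lambda>t. indicator {0..} t * (sqrt t * exp (- (c * t))))"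
  proof
    fix t
    have "0 \<le> c * t \<longleftrightarrow> 0 \<le> t"
      using c by (simp add: zero_le_mult_iff)
    then have "indicator {0..} (0 + c * t) = (indicator {0..} t :: real)"
      by (simp add: indicator_def)
    moreover have "sqrt (0 + c * t) = sqrt c * sqrt t"
      by (simp add: real_sqrt_mult)
    ultimately show "indicator {0..} (0 + c * t) * (sqrt (0 + c * t) * exp (- (0 + c * t))) / sqrt c
        = indicator {0..} t * (sqrt t * exp (- (c * t)))"
      using c by simp
  qed
  also have "Gamma (3 / 2) /\<^sub>R \<bar>c\<bar> / sqrt c = Gamma (3 / 2) / (c * sqrt c)"
    using c by (simp add: field_simps)
  finally show ?thesis .
qed

text \<open>This is the differentiated generating function at w = z exp(-t), times sqrt t exp(-t);
  the extra exponential raises the decay of the n-th term to exp(-(n + 1) t).\<close>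

lemma kernel_integrand_sums:
  assumes z: "cmod z < 1" and t: "t \<ge> 0"
  shows "summable (\<lambda>n. cmod (of_nat (Suc n) * of_real (laguerre (Suc n) x) * z ^ n * of_real (sqrt t * exp (- (real (Suc n) * t)))))"
    and "(\<lambda>n. of_nat (Suc n) * of_real (laguerre (Suc n) x) * z ^ n * of_real (sqrt t * exp (- (real (Suc n) * t))))
      sums kernel_integrand z x t"
proof -
  define w where "w = z * of_real (exp (- t))"
  have "cmod w = cmod z * exp (- t)"
    by (simp add: w_def norm_mult)
  also have "\<dots> \<le> cmod z * 1"
    using t by (intro mult_left_mono) auto
  finally have w: "cmod w < 1"
    using z by simp
  have term_eq: "of_real (sqrt t * exp (- t)) * (of_nat (Suc n) * of_real (laguerre (Suc n) x) * w ^ n)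
      = of_nat (Suc n) * of_real (laguerre (Suc n) x) * z ^ n * of_real (sqrt t * exp (- (real (Suc n) * t)))" for n
  proof -
    have "exp (- t) * exp (- t) ^ n = exp (- (real (Suc n) * t))"
      by (metis exp_of_nat_mult mult_minus_right power_Suc)
    then have *: "complex_of_real (exp (- t)) * of_real (exp (- t)) ^ n = of_real (exp (- (real (Suc n) * t)))"
      by (metis of_real_mult of_real_power)
    then show ?thesis
      by (simp only: *[symmetric] w_def power_mult_distrib of_real_mult mult_ac)
  qed
  have val: "of_real (sqrt t * exp (- t)) * (exp (- of_real x * w / (1 - w)) / (1 - w)\<^sup>2 * (1 - of_real x / (1 - w)))
      = kernel_integrand z x t"
    by (simp add: kernel_integrand_def laguerre_1_def w_def power_int_minus divide_inverse mult_ac)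
  show "summable (\<lambda>n. cmod (of_nat (Suc n) * of_real (laguerre (Suc n) x) * z ^ n * of_real (sqrt t * exp (- (real (Suc n) * t)))))"
    using summable_mult[OF laguerre_generating_function_deriv(1)[OF w, of x], of "cmod (of_real (sqrt t * exp (- t)))"]
    by (simp only: norm_mult[symmetric] term_eq)
  show "(\<lambda>n. of_nat (Suc n) * of_real (laguerre (Suc n) x) * z ^ n * of_real (sqrt t * exp (- (real (Suc n) * t))))
      sums kernel_integrand z x t"
    using sums_mult[OF laguerre_generating_function_deriv(2)[OF w, of x], of "of_real (sqrt t * exp (- t))"]
    unfolding term_eq val .
qed

text \<open>Integrating term by term divides the factor n + 1 of the differentiated series by (n +
  1) sqrt(n + 1), which leaves 1/sqrt(n + 1); the prefactor cancels Gamma(3/2) and raises the power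
  of z by one.\<close>

lemma kernel_part_sums:
  assumes z: "cmod z < 1"
  shows "set_integrable lborel {0..} (kernel_integrand z x)"
    and "(\<lambda>n. z ^ Suc n / of_real (sqrt (real (Suc n))) * of_real (laguerre (Suc n) x)) sums kernel_part z x"
proof -
  define c where "c n = of_nat (Suc n) * complex_of_real (laguerre (Suc n) x) * z ^ n" for n
  define e where "e n t = indicator {0..} t * (sqrt t * exp (- (real (Suc n) * t)))" for n and t :: real
  define F where "F n t = c n * of_real (e n t)" for n and t :: real
  have e: "has_bochner_integral lborel (e n) (Gamma (3 / 2) / (real (Suc n) * sqrt (real (Suc n))))" for n
    unfolding e_def by (rule has_bochner_integral_sqrt_exp) simp
  have e_nonneg: "0 \<le> e n t" for n t
    by (auto simp: e_def indicator_def)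
  have F: "has_bochner_integral lborel (F n) (c n * of_real (Gamma (3 / 2) / (real (Suc n) * sqrt (real (Suc n)))))" for n
    unfolding F_def by (intro has_bochner_integral_mult_right has_bochner_integral_of_real e)
  have int: "integrable lborel (F n)" for n
    using F[of n] by (simp only: has_bochner_integral_iff)
  have F_eq: "F n t = indicator {0..} t *\<^sub>R (of_nat (Suc n) * of_real (laguerre (Suc n) x) * z ^ n * of_real (sqrt t * exp (- (real (Suc n) * t))))" for n t
    by (simp add: F_def c_def e_def indicator_def)
  have F_summable: "summable (\<lambda>n. cmod (F n t))" for t
    unfolding F_eq using kernel_integrand_sums(1)[OF z, of t x] by (cases "t \<ge> 0") (auto simp del: of_nat_Suc power_Suc)
  have F_sums: "(\<Sum>n. F n t) = indicator {0..} t *\<^sub>R kernel_integrand z x t" for t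
    unfolding F_eq using sums_unique[OF kernel_integrand_sums(2)[OF z, of t x]]
    by (cases "t \<ge> 0") (auto simp del: of_nat_Suc power_Suc)
  have norm_int: "(LINT t|lborel. cmod (F n t)) = cmod (c n) * (Gamma (3 / 2) / (real (Suc n) * sqrt (real (Suc n))))" for n
    using e[of n] e_nonneg unfolding F_def norm_mult norm_of_real
    by (simp add: has_bochner_integral_iff abs_of_nonneg)
  have summ: "summable (\<lambda>n. LINT t|lborel. cmod (F n t))"
  proof (rule summable_comparison_test')
    show "summable (\<lambda>n. cmod (c n) * Gamma (3 / 2))"
      unfolding c_def by (intro summable_mult2 laguerre_generating_function_deriv z)
    show "norm (LINT t|lborel. cmod (F n t)) \<le> cmod (c n) * Gamma (3 / 2)" if "n \<ge> 0" for n
    proof -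
      \<comment> \<open>The decay in n can be given away: the differentiated series converges
        absolutely by itself for |z| < 1.\<close>
      have "1 \<le> real (Suc n) * sqrt (real (Suc n))"
        by (intro mult_ge1_I) auto
      then have "Gamma (3 / 2) / (real (Suc n) * sqrt (real (Suc n))) \<le> Gamma (3 / 2 :: real) / 1"
        by (intro divide_left_mono) (auto simp: Gamma_real_pos less_imp_le)
      then have "cmod (c n) * (Gamma (3 / 2) / (real (Suc n) * sqrt (real (Suc n)))) \<le> cmod (c n) * Gamma (3 / 2)"
        by (intro mult_left_mono) auto
      moreover have "0 \<le> (LINT t|lborel. cmod (F n t))"
        by (intro integral_nonneg_AE) auto
      ultimately show ?thesis
        unfolding norm_int by simp
    qed
  qed
  have AE: "AE t in lborel. summable (\<lambda>n. cmod (F n t))"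
    by (intro AE_I2 F_summable)
  show "set_integrable lborel {0..} (kernel_integrand z x)"
    unfolding set_integrable_def using integrable_suminf[OF int AE summ] by (simp only: F_sums)
  have "(\<lambda>n. LINT t|lborel. F n t) sums (LINT t:{0..}|lborel. kernel_integrand z x t)"
    unfolding set_lebesgue_integral_def using sums_integral[OF int AE summ] by (simp only: F_sums)
  then have "(\<lambda>n. z / of_real (Gamma (3 / 2)) * (LINT t|lborel. F n t)) sums kernel_part z x"
    unfolding kernel_part_def by (rule sums_mult)
  moreover have "z / of_real (Gamma (3 / 2)) * (LINT t|lborel. F n t) = z ^ Suc n / of_real (sqrt (real (Suc n))) * of_real (laguerre (Suc n) x)" for n
  proof -
    have "(LINT t|lborel. F n t) = c n * of_real (Gamma (3 / 2) / (real (Suc n) * sqrt (real (Suc n))))"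
      using F[of n] by (rule has_bochner_integral_integral_eq)
    moreover have "Gamma (3 / 2 :: real) \<noteq> 0"
      by (rule less_imp_neq[symmetric], rule Gamma_real_pos) simp
    moreover have "complex_of_nat (Suc n) = of_real (real (Suc n))" "real (Suc n) \<noteq> 0"
      by simp_all
    ultimately show ?thesis
      by (simp add: c_def del: of_nat_Suc of_real_of_nat_eq)
  qed
  ultimately show "(\<lambda>n. z ^ Suc n / of_real (sqrt (real (Suc n))) * of_real (laguerre (Suc n) x)) sums kernel_part z x"
    by simp
qed

text \<open>The parameters \<open>\<alpha>\<close> below and \<open>\<kappa>\<close> in \<open>dirichlet_ip\<close> treat both normalizations of the
  constant term at once; the transform is unitary when \<open>\<kappa> \<alpha>\<^sup>2 = 1\<close>.\<close>

definition kernel_weight :: "real \<Rightarrow> nat \<Rightarrow> real" where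
  "kernel_weight \<alpha> n = (if n = 0 then \<alpha> else 1 / sqrt (pi * real n))"

definition dirichlet_kernel :: "real \<Rightarrow> complex \<Rightarrow> real \<Rightarrow> complex" where
  "dirichlet_kernel \<alpha> z x = of_real \<alpha> + 1 / of_real (sqrt pi) * kernel_part z x"

lemma bargmann_kernel_eq: "bargmann_kernel = dirichlet_kernel (1 / sqrt pi)"
  by (intro ext) (simp add: bargmann_kernel_def dirichlet_kernel_def add_divide_distrib)

lemma bargmann_kernel_unit_eq: "bargmann_kernel_unit = dirichlet_kernel 1"
  by (intro ext) (simp add: bargmann_kernel_unit_def dirichlet_kernel_def)

lemma dirichlet_kernel_sums:
  assumes z: "cmod z < 1"
  shows "(\<lambda>n. of_real (kernel_weight \<alpha> n) * z ^ n * of_real (laguerre n x)) sums dirichlet_kernel \<alpha> z x"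
proof -
  have "(\<lambda>n. 1 / of_real (sqrt pi) * (z ^ Suc n / of_real (sqrt (real (Suc n))) * of_real (laguerre (Suc n) x)))
      sums (1 / of_real (sqrt pi) * kernel_part z x)"
    by (intro sums_mult kernel_part_sums z)
  then have "(\<lambda>n. of_real (kernel_weight \<alpha> (Suc n)) * z ^ Suc n * of_real (laguerre (Suc n) x))
      sums (1 / of_real (sqrt pi) * kernel_part z x)"
    by (simp add: kernel_weight_def real_sqrt_mult del: of_nat_Suc power_Suc)
  from sums_Suc[OF this] show ?thesis
    by (simp add: dirichlet_kernel_def kernel_weight_def add.commute)
qed

section \<open>The transform\<close>

definition dirichlet_ip :: "real \<Rightarrow> (complex \<Rightarrow> complex) \<Rightarrow> (complex \<Rightarrow> complex) \<Rightarrow> complex" where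
  "dirichlet_ip \<kappa> f g = of_real \<kappa> * (f 0 * cnj (g 0)) + (LINT z:unit_disk|lborel. deriv f z * cnj (deriv g z))"

lemma dirichlet_inner_eq: "dirichlet_inner = dirichlet_ip 1"
  by (intro ext) (simp add: dirichlet_inner_def dirichlet_ip_def)

lemma dirichlet_inner_area_eq: "dirichlet_inner_area = dirichlet_ip pi"
  by (intro ext) (simp add: dirichlet_inner_area_def dirichlet_ip_def)

text \<open>The \<open>ennreal\<close> identity for the Dirichlet integral is read in both
  directions: finiteness of the integral is convergence of the series.\<close>

lemma dirichlet_integral_power_series:
  fixes a :: "nat \<Rightarrow> complex"
  assumes sums: "\<And>z. cmod z < 1 \<Longrightarrow> (\<lambda>n. a n * z ^ n) sums f z"
  shows "f \<in> dirichlet_space \<longleftrightarrow> summable (\<lambda>n. pi * real n * (cmod (a n))\<^sup>2)"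
    and "summable (\<lambda>n. pi * real n * (cmod (a n))\<^sup>2) \<Longrightarrow>
      (LINT z:unit_disk|lborel. (cmod (deriv f z))\<^sup>2) = (\<Sum>n. pi * real n * (cmod (a n))\<^sup>2)"
proof -
  have hol: "f holomorphic_on unit_disk"
    by (rule power_series_holomorphic[where a = a]) (simp add: sums)
  then have "continuous_on unit_disk (deriv f)"
    by (intro holomorphic_on_imp_continuous_on holomorphic_deriv) auto
  then have "continuous_on unit_disk (\<lambda>z. (cmod (deriv f z))\<^sup>2)"
    by (intro continuous_intros)
  then have meas: "(\<lambda>z. indicator unit_disk z *\<^sub>R (cmod (deriv f z))\<^sup>2) \<in> borel_measurable lborel"
    using borel_measurable_continuous_on_indicator[of unit_disk "\<lambda>z. (cmod (deriv f z))\<^sup>2"] by simp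
  have "(\<integral>\<^sup>+z. ennreal (indicator unit_disk z *\<^sub>R (cmod (deriv f z))\<^sup>2) \<partial>lborel)
      = (\<integral>\<^sup>+z\<in>unit_disk. ennreal ((cmod (deriv f z))\<^sup>2) \<partial>lborel)"
    by (intro nn_integral_cong) (auto simp: indicator_def)
  then have nn: "(\<integral>\<^sup>+z. ennreal (indicator unit_disk z *\<^sub>R (cmod (deriv f z))\<^sup>2) \<partial>lborel)
      = (\<Sum>n. ennreal (pi * real n * (cmod (a n))\<^sup>2))"
    by (simp only: nn_integral_deriv_power_series[OF sums])
  have summable: "has_bochner_integral lborel (\<lambda>z. indicator unit_disk z *\<^sub>R (cmod (deriv f z))\<^sup>2) (\<Sum>n. pi * real n * (cmod (a n))\<^sup>2)"
    if "summable (\<lambda>n. pi * real n * (cmod (a n))\<^sup>2)"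
  proof (rule has_bochner_integral_nn_integral[OF meas])
    show "(\<integral>\<^sup>+z. ennreal (indicator unit_disk z *\<^sub>R (cmod (deriv f z))\<^sup>2) \<partial>lborel)
        = ennreal (\<Sum>n. pi * real n * (cmod (a n))\<^sup>2)"
      unfolding nn using that by (intro suminf_ennreal2) auto
    show "0 \<le> (\<Sum>n. pi * real n * (cmod (a n))\<^sup>2)"
      using that by (intro suminf_nonneg) auto
  qed auto
  show "f \<in> dirichlet_space \<longleftrightarrow> summable (\<lambda>n. pi * real n * (cmod (a n))\<^sup>2)"
  proof
    assume "f \<in> dirichlet_space"
    then have "integrable lborel (\<lambda>z. indicator unit_disk z *\<^sub>R (cmod (deriv f z))\<^sup>2)"
      by (simp add: dirichlet_space_def set_integrable_def)
    then have "(\<integral>\<^sup>+z. ennreal (indicator unit_disk z *\<^sub>R (cmod (deriv f z))\<^sup>2) \<partial>lborel) \<noteq> top"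
      by (subst nn_integral_eq_integral) auto
    then show "summable (\<lambda>n. pi * real n * (cmod (a n))\<^sup>2)"
      unfolding nn by (intro summable_suminf_not_top) auto
  next
    assume "summable (\<lambda>n. pi * real n * (cmod (a n))\<^sup>2)"
    from summable[OF this] hol show "f \<in> dirichlet_space"
      unfolding dirichlet_space_def set_integrable_def has_bochner_integral_iff by blast
  qed
  show "(LINT z:unit_disk|lborel. (cmod (deriv f z))\<^sup>2) = (\<Sum>n. pi * real n * (cmod (a n))\<^sup>2)"
    if "summable (\<lambda>n. pi * real n * (cmod (a n))\<^sup>2)"
    using summable[OF that] unfolding set_lebesgue_integral_def by (rule has_bochner_integral_integral_eq)
qed

text \<open>Polarization holds pointwise and is then integrated. It is applied over the disk and
  over the half-line measure, so that equality of norms becomes equality of scalar products.\<close>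

lemma set_integral_polarization:
  fixes f g :: "'a \<Rightarrow> complex"
  assumes "\<And>u. set_integrable M A (\<lambda>x. (cmod (f x + u * g x))\<^sup>2)"
  defines "N \<equiv> (\<lambda>u. complex_of_real (LINT x:A|M. (cmod (f x + u * g x))\<^sup>2))"
  shows "(LINT x:A|M. f x * cnj (g x)) = (N 1 - N (- 1) + \<i> * N \<i> - \<i> * N (- \<i>)) / 4"
proof -
  define h where "h u x = complex_of_real ((cmod (f x + u * g x))\<^sup>2)" for u x
  have int: "set_integrable M A (h u)" for u
  proof -
    have "indicator A x *\<^sub>R h u x = complex_of_real (indicator A x *\<^sub>R (cmod (f x + u * g x))\<^sup>2)" for x
      by (simp add: h_def scaleR_conv_of_real)
    then show ?thesis
      using assms(1)[of u] by (simp only: set_integrable_def complex_of_real_integrable_eq)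
  qed
  have N: "N u = (LINT x:A|M. h u x)" for u
    unfolding N_def h_def by (rule set_integral_complex_of_real[symmetric])
  have "f x * cnj (g x) = (h 1 x - h (- 1) x + \<i> * h \<i> x - \<i> * h (- \<i>) x) / 4" for x
    unfolding h_def complex_norm_square by (simp add: algebra_simps)
  then have "(LINT x:A|M. f x * cnj (g x)) = (LINT x:A|M. (h 1 x - h (- 1) x + \<i> * h \<i> x - \<i> * h (- \<i>) x) / 4)"
    by (simp only:)
  also have "\<dots> = (LINT x:A|M. h 1 x - h (- 1) x + \<i> * h \<i> x - \<i> * h (- \<i>) x) / 4"
    by (rule set_integral_divide_zero)
  also have "(LINT x:A|M. h 1 x - h (- 1) x + \<i> * h \<i> x - \<i> * h (- \<i>) x)
      = (LINT x:A|M. h 1 x) - (LINT x:A|M. h (- 1) x) + (LINT x:A|M. \<i> * h \<i> x) - (LINT x:A|M. \<i> * h (- \<i>) x)"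
    using int by (simp add: set_integral_add set_integral_diff)
  also have "\<dots> = N 1 - N (- 1) + \<i> * N \<i> - \<i> * N (- \<i>)"
    unfolding N by simp
  finally show ?thesis .
qed

section \<open>The transform in coefficients: isometry and bijectivity\<close>

context
  fixes \<alpha> :: real
begin

lemma abs_kernel_weight_le: "\<bar>kernel_weight \<alpha> n\<bar> \<le> max \<bar>\<alpha>\<bar> 1"
proof (cases "n = 0")
  case False
  have "1 * 1 \<le> pi * real n"
    using False pi_gt3 by (intro mult_mono) auto
  then have "1 \<le> sqrt (pi * real n)"
    by simp
  then have "1 / sqrt (pi * real n) \<le> 1"
    by (simp add: divide_le_eq)
  then show ?thesis
    using False by (simp add: kernel_weight_def le_max_iff_disj)
qed (simp add: kernel_weight_def)

text \<open>The transform is diagonal: the Taylor coefficients of the image are the Laguerre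
  coefficients of f times the weights. As the weights are bounded, |z| < 1 gives the absolute
  convergence needed to integrate termwise.\<close>

lemma bargmann_transform_sums:
  assumes f: "f \<in> laguerre_L2" and z: "cmod z < 1"
  shows "integrable laguerre_measure (\<lambda>x. dirichlet_kernel \<alpha> z x * f x)"
    and "(\<lambda>n. of_real (kernel_weight \<alpha> n) * laguerre_coeff f n * z ^ n) sums bargmann_transform (dirichlet_kernel \<alpha>) f z"
proof -
  define b where "b n = of_real (kernel_weight \<alpha> n) * z ^ n" for n
  have b_le: "cmod (b n) \<le> max \<bar>\<alpha>\<bar> 1 * cmod z ^ n" for n
    unfolding b_def norm_mult norm_of_real norm_power by (intro mult_right_mono abs_kernel_weight_le) auto
  have 1: "summable (\<lambda>n. cmod (b n))"
  proof (rule summable_comparison_test')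
    show "summable (\<lambda>n. max \<bar>\<alpha>\<bar> 1 * cmod z ^ n)"
      using z by (intro summable_mult summable_geometric) simp
    show "norm (cmod (b n)) \<le> max \<bar>\<alpha>\<bar> 1 * cmod z ^ n" if "n \<ge> 0" for n
      using b_le[of n] by simp
  qed
  have 2: "summable (\<lambda>n. cmod (b n * of_real (laguerre n x)))" for x
  proof (rule summable_comparison_test')
    show "summable (\<lambda>n. max \<bar>\<alpha>\<bar> 1 * cmod (of_real (laguerre n x) * z ^ n))"
      by (intro summable_mult laguerre_generating_function z)
    show "norm (cmod (b n * of_real (laguerre n x))) \<le> max \<bar>\<alpha>\<bar> 1 * cmod (of_real (laguerre n x) * z ^ n)" if "n \<ge> 0" for n
      using mult_right_mono[OF b_le[of n], of "\<bar>laguerre n x\<bar>"] by (simp add: norm_mult norm_power mult_ac)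
  qed
  have kernel: "(\<Sum>n. b n * of_real (laguerre n x)) = dirichlet_kernel \<alpha> z x" for x
    unfolding b_def using dirichlet_kernel_sums[OF z] by (rule sums_unique[symmetric])
  show "integrable laguerre_measure (\<lambda>x. dirichlet_kernel \<alpha> z x * f x)"
    using laguerre_expansion_integral(1)[OF f 1 2] by (simp only: kernel)
  show "(\<lambda>n. of_real (kernel_weight \<alpha> n) * laguerre_coeff f n * z ^ n) sums bargmann_transform (dirichlet_kernel \<alpha>) f z"
    using laguerre_expansion_integral(2)[OF f 1 2, unfolded kernel] unfolding bargmann_transform_def b_def
    by (simp only: mult_ac)
qed

lemma bargmann_transform_lincomb:
  assumes f: "f \<in> laguerre_L2" and g: "g \<in> laguerre_L2" and z: "cmod z < 1"
  shows "bargmann_transform (dirichlet_kernel \<alpha>) (\<lambda>x. a * f x + b * g x) z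
    = a * bargmann_transform (dirichlet_kernel \<alpha>) f z + b * bargmann_transform (dirichlet_kernel \<alpha>) g z"
proof -
  note int = bargmann_transform_sums(1)[OF f z] bargmann_transform_sums(1)[OF g z]
  have "bargmann_transform (dirichlet_kernel \<alpha>) (\<lambda>x. a * f x + b * g x) z
      = (LINT x|laguerre_measure. a * (dirichlet_kernel \<alpha> z x * f x) + b * (dirichlet_kernel \<alpha> z x * g x))"
    unfolding bargmann_transform_def by (simp add: algebra_simps)
  also have "\<dots> = (LINT x|laguerre_measure. a * (dirichlet_kernel \<alpha> z x * f x)) + (LINT x|laguerre_measure. b * (dirichlet_kernel \<alpha> z x * g x))"
    by (intro Bochner_Integration.integral_add integrable_mult_right int)
  finally show ?thesis
    by (simp add: bargmann_transform_def)
qed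

lemma bargmann_transform_cong:
  assumes f: "f \<in> laguerre_L2" and g: "g \<in> laguerre_L2" and z: "cmod z < 1" and "laguerre_eq f g"
  shows "bargmann_transform (dirichlet_kernel \<alpha>) f z = bargmann_transform (dirichlet_kernel \<alpha>) g z"
  unfolding bargmann_transform_def
proof (rule integral_cong_AE)
  show "AE x in laguerre_measure. dirichlet_kernel \<alpha> z x * f x = dirichlet_kernel \<alpha> z x * g x"
    using assms(4) unfolding laguerre_eq_def by eventually_elim simp
qed (auto intro: borel_measurable_integrable bargmann_transform_sums f g z)

text \<open>For n \<ge> 1 the squared weight cancels pi n, so the Dirichlet integral is the Parseval
  sum without its term at 0; the value at the origin restores that term because \<kappa> \<alpha>^2
  = 1.\<close>

lemma bargmann_transform_isometry:
  assumes f: "f \<in> laguerre_L2" and \<kappa>: "\<kappa> * \<alpha>\<^sup>2 = 1"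
  defines "F \<equiv> bargmann_transform (dirichlet_kernel \<alpha>) f"
  shows "F \<in> dirichlet_space"
    and "\<kappa> * (cmod (F 0))\<^sup>2 + (LINT z:unit_disk|lborel. (cmod (deriv F z))\<^sup>2)
      = (LINT x|laguerre_measure. (cmod (f x))\<^sup>2)"
proof -
  define a where "a n = of_real (kernel_weight \<alpha> n) * laguerre_coeff f n" for n
  define c where "c n = (cmod (laguerre_coeff f n))\<^sup>2" for n
  have sums: "(\<lambda>n. a n * z ^ n) sums F z" if "cmod z < 1" for z
    unfolding a_def F_def using f that by (rule bargmann_transform_sums)
  have c_sums: "c sums (LINT x|laguerre_measure. (cmod (f x))\<^sup>2)"
    unfolding c_def by (rule laguerre_Parseval[OF f])
  have "pi * real n * (cmod (a n))\<^sup>2 = (if n = 0 then 0 else c n)" for n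
    by (simp add: a_def c_def kernel_weight_def norm_mult norm_divide power_mult_distrib power_divide)
  then have eq: "(\<lambda>n. pi * real n * (cmod (a n))\<^sup>2) = (\<lambda>n. if n = 0 then 0 else c n)"
    by blast
  have "(\<lambda>n. c n - (if n = 0 then c 0 else 0)) sums ((LINT x|laguerre_measure. (cmod (f x))\<^sup>2) - c 0)"
    using sums_diff[OF c_sums sums_single[of 0 "\<lambda>_. c 0"]] by simp
  also have "(\<lambda>n. c n - (if n = 0 then c 0 else 0)) = (\<lambda>n. pi * real n * (cmod (a n))\<^sup>2)"
    unfolding eq by auto
  finally have *: "(\<lambda>n. pi * real n * (cmod (a n))\<^sup>2) sums ((LINT x|laguerre_measure. (cmod (f x))\<^sup>2) - c 0)" .
  show "F \<in> dirichlet_space"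
    using dirichlet_integral_power_series(1)[OF sums] sums_summable[OF *] by blast
  have "F 0 = a 0"
    using sums_unique2[OF sums[of 0] powser_sums_zero[of a]] by simp
  then have "\<kappa> * (cmod (F 0))\<^sup>2 = (\<kappa> * \<alpha>\<^sup>2) * c 0"
    by (simp add: a_def c_def kernel_weight_def norm_mult power_mult_distrib)
  then show "\<kappa> * (cmod (F 0))\<^sup>2 + (LINT z:unit_disk|lborel. (cmod (deriv F z))\<^sup>2)
      = (LINT x|laguerre_measure. (cmod (f x))\<^sup>2)"
    using dirichlet_integral_power_series(2)[OF sums sums_summable[OF *]] sums_unique[OF *] \<kappa> by simp
qed

text \<open>The isometry is applied to f + u g for the four values of u used in
  polarization.\<close>

lemma bargmann_transform_inner:
  assumes f: "f \<in> laguerre_L2" and g: "g \<in> laguerre_L2" and \<kappa>: "\<kappa> * \<alpha>\<^sup>2 = 1"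
  shows "dirichlet_ip \<kappa> (bargmann_transform (dirichlet_kernel \<alpha>) f) (bargmann_transform (dirichlet_kernel \<alpha>) g)
    = laguerre_inner f g"
proof -
  define T where "T = bargmann_transform (dirichlet_kernel \<alpha>)"
  define h where "h u x = f x + u * g x" for u x
  have h: "h u \<in> laguerre_L2" for u
    using laguerre_L2_lincomb[OF f g, of 1 u] by (simp add: h_def[abs_def])
  have Th: "T (h u) z = T f z + u * T g z" if "cmod z < 1" for u z
    using bargmann_transform_lincomb[OF f g that, of 1 u] by (simp add: T_def h_def[abs_def])
  have hol: "T k holomorphic_on unit_disk" "set_integrable lborel unit_disk (\<lambda>z. (cmod (deriv (T k) z))\<^sup>2)"
    if "k \<in> laguerre_L2" for k
    using bargmann_transform_isometry(1)[OF that \<kappa>] by (auto simp: dirichlet_space_def T_def)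
  have deriv: "deriv (T (h u)) z = deriv (T f) z + u * deriv (T g) z" if z: "z \<in> unit_disk" for u z
  proof -
    have diff: "T f field_differentiable at z" "T g field_differentiable at z"
      using hol(1)[OF f] hol(1)[OF g] z by (auto simp: holomorphic_on_imp_differentiable_at)
    have "eventually (\<lambda>w. T (h u) w = T f w + u * T g w) (nhds z)"
      using eventually_nhds_in_open[OF open_ball z] by eventually_elim (simp add: Th)
    then have "deriv (T (h u)) z = deriv (\<lambda>w. T f w + u * T g w) z"
      by (rule deriv_cong_ev) simp
    also have "\<dots> = deriv (T f) z + u * deriv (T g) z"
      using diff by (simp add: deriv_add deriv_cmult field_differentiable_mult)
    finally show ?thesis .
  qed
  \<comment> \<open>Squared norms of the constant part, the derivative part and the half-line side.
    They satisfy P + Q = R, and all three polarize by the same formula.\<close>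
  define P where "P u = complex_of_real (\<kappa> * (cmod (T f 0 + u * T g 0))\<^sup>2)" for u
  define Q where "Q u = complex_of_real (LINT z:unit_disk|lborel. (cmod (deriv (T f) z + u * deriv (T g) z))\<^sup>2)" for u
  define R where "R u = complex_of_real (LINT x:UNIV|laguerre_measure. (cmod (f x + u * g x))\<^sup>2)" for u
  have int_eq: "set_integrable lborel unit_disk (\<lambda>z. (cmod (deriv (T f) z + u * deriv (T g) z))\<^sup>2)
      \<longleftrightarrow> set_integrable lborel unit_disk (\<lambda>z. (cmod (deriv (T (h u)) z))\<^sup>2)" for u
    by (rule set_integrable_cong) (simp_all add: deriv)
  have lint_eq: "(LINT z:unit_disk|lborel. (cmod (deriv (T f) z + u * deriv (T g) z))\<^sup>2)
      = (LINT z:unit_disk|lborel. (cmod (deriv (T (h u)) z))\<^sup>2)" for u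
    by (rule set_lebesgue_integral_cong) (simp_all add: deriv)
  have PQR: "P u + Q u = R u" for u
    using bargmann_transform_isometry(2)[OF h[of u] \<kappa>]
    unfolding P_def Q_def R_def lint_eq T_def[symmetric] of_real_add[symmetric]
    by (simp add: Th h_def set_lebesgue_integral_def)
  have area: "(LINT z:unit_disk|lborel. deriv (T f) z * cnj (deriv (T g) z)) = (Q 1 - Q (- 1) + \<i> * Q \<i> - \<i> * Q (- \<i>)) / 4"
    unfolding Q_def by (rule set_integral_polarization) (simp add: int_eq hol h)
  have const: "of_real \<kappa> * (T f 0 * cnj (T g 0)) = (P 1 - P (- 1) + \<i> * P \<i> - \<i> * P (- \<i>)) / 4"
    unfolding P_def of_real_mult complex_norm_square by (simp add: algebra_simps)
  have inner: "(LINT x:UNIV|laguerre_measure. f x * cnj (g x)) = (R 1 - R (- 1) + \<i> * R \<i> - \<i> * R (- \<i>)) / 4"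
    unfolding R_def
    by (rule set_integral_polarization) (use laguerre_L2_D(2)[OF h] in \<open>simp add: set_integrable_def h_def\<close>)
  have "dirichlet_ip \<kappa> (T f) (T g) = (LINT x:UNIV|laguerre_measure. f x * cnj (g x))"
    unfolding dirichlet_ip_def area const inner PQR[symmetric]
    by (simp add: algebra_simps flip: add_divide_distrib)
  then show ?thesis
    by (simp add: laguerre_inner_def set_lebesgue_integral_def T_def)
qed

lemma bargmann_transform_inj:
  assumes f: "f \<in> laguerre_L2" and g: "g \<in> laguerre_L2" and \<kappa>: "\<kappa> * \<alpha>\<^sup>2 = 1"
    and eq: "disk_eq (bargmann_transform (dirichlet_kernel \<alpha>) f) (bargmann_transform (dirichlet_kernel \<alpha>) g)"
  shows "laguerre_eq f g"
proof -
  define d where "d x = f x - g x" for x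
  define F where "F = bargmann_transform (dirichlet_kernel \<alpha>) d"
  have d: "d \<in> laguerre_L2"
    unfolding d_def by (intro laguerre_L2_diff f g)
  have F: "F z = 0" if "z \<in> unit_disk" for z
    using bargmann_transform_lincomb[OF f g, of z 1 "-1"] eq that by (simp add: F_def d_def[abs_def] disk_eq_def)
  have "deriv F z = 0" if z: "z \<in> unit_disk" for z
  proof -
    have "eventually (\<lambda>w. F w = 0) (nhds z)"
      using eventually_nhds_in_open[OF open_ball z] by eventually_elim (simp add: F)
    then have "deriv F z = deriv (\<lambda>w. 0) z"
      by (rule deriv_cong_ev) simp
    then show ?thesis by simp
  qed
  then have "(LINT z:unit_disk|lborel. (cmod (deriv F z))\<^sup>2) = (LINT z:unit_disk|lborel. 0)"
    by (intro set_lebesgue_integral_cong) auto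
  then have "(LINT x|laguerre_measure. (cmod (d x))\<^sup>2) = 0"
    using bargmann_transform_isometry(2)[OF d \<kappa>] F[of 0] by (simp add: F_def set_lebesgue_integral_def)
  then have "AE x in laguerre_measure. (cmod (d x))\<^sup>2 = 0"
    using laguerre_L2_D(2)[OF d] by (subst (asm) integral_nonneg_eq_0_iff_AE) auto
  then show ?thesis
    unfolding laguerre_eq_def by eventually_elim (simp add: d_def)
qed

text \<open>Dividing the Taylor coefficients of g by the weights must leave a square summable
  sequence; this is exactly finiteness of the Dirichlet integral of g.\<close>

lemma bargmann_transform_surj:
  assumes \<alpha>: "\<alpha> \<noteq> 0" and g: "g \<in> dirichlet_space"
  obtains f where "f \<in> laguerre_L2" "disk_eq (bargmann_transform (dirichlet_kernel \<alpha>) f) g"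
proof -
  define a where "a n = (deriv ^^ n) g 0 / fact n" for n
  define c where "c n = a n / of_real (kernel_weight \<alpha> n)" for n
  have sums: "(\<lambda>n. a n * z ^ n) sums g z" if "cmod z < 1" for z
    using holomorphic_power_series[of g 0 1 z] g that by (simp add: a_def dirichlet_space_def)
  have w: "kernel_weight \<alpha> n \<noteq> 0" for n
    using \<alpha> by (simp add: kernel_weight_def)
  have "summable (\<lambda>n. pi * real n * (cmod (a n))\<^sup>2)"
    using dirichlet_integral_power_series(1)[OF sums] g by blast
  \<comment> \<open>Equality in fact, but only from n = 1 on: at n = 0 the right side is 0 whereas c
    0 may not be.\<close>
  moreover have "norm ((cmod (c n))\<^sup>2) \<le> pi * real n * (cmod (a n))\<^sup>2" if "n \<ge> 1" for n
    using that by (simp add: c_def kernel_weight_def norm_mult norm_divide power_mult_distrib power_divide)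
  ultimately have "summable (\<lambda>n. (cmod (c n))\<^sup>2)"
    by (rule summable_comparison_test')
  then obtain f where f: "f \<in> laguerre_L2" "\<And>n. laguerre_coeff f n = c n"
    using laguerre_Riesz_Fischer by blast
  have "bargmann_transform (dirichlet_kernel \<alpha>) f z = g z" if "cmod z < 1" for z
  proof (rule sums_unique2)
    show "(\<lambda>n. of_real (kernel_weight \<alpha> n) * laguerre_coeff f n * z ^ n) sums bargmann_transform (dirichlet_kernel \<alpha>) f z"
      by (rule bargmann_transform_sums(2)[OF f(1) that])
    show "(\<lambda>n. of_real (kernel_weight \<alpha> n) * laguerre_coeff f n * z ^ n) sums g z"
      using sums[OF that] w by (simp add: f(2) c_def)
  qed
  then show thesis
    using that[OF f(1)] by (simp add: disk_eq_def)
qed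

lemma bargmann_transform_unitary:
  assumes \<kappa>: "\<kappa> * \<alpha>\<^sup>2 = 1"
  shows "unitary_isomorphism laguerre_L2 laguerre_eq laguerre_inner
    dirichlet_space disk_eq (dirichlet_ip \<kappa>) (bargmann_transform (dirichlet_kernel \<alpha>))"
  unfolding unitary_isomorphism_def
proof (intro conjI ballI allI)
  let ?T = "bargmann_transform (dirichlet_kernel \<alpha>)"
  show "?T f \<in> dirichlet_space" if "f \<in> laguerre_L2" for f
    by (rule bargmann_transform_isometry(1)[OF that \<kappa>])
  show "laguerre_eq f g \<longleftrightarrow> disk_eq (?T f) (?T g)" if "f \<in> laguerre_L2" "g \<in> laguerre_L2" for f g
    using bargmann_transform_inj[OF that \<kappa>] bargmann_transform_cong[OF that] by (auto simp: disk_eq_def)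
  show "\<exists>f\<in>laguerre_L2. disk_eq (?T f) g" if "g \<in> dirichlet_space" for g
    using bargmann_transform_surj[OF _ that] \<kappa> by (metis mult_zero_right zero_neq_one zero_power2)
  show "disk_eq (?T (\<lambda>x. a * f x + b * g x)) (\<lambda>z. a * ?T f z + b * ?T g z)"
    if "f \<in> laguerre_L2" "g \<in> laguerre_L2" for a b f g
    using bargmann_transform_lincomb[OF that] by (simp add: disk_eq_def)
  show "dirichlet_ip \<kappa> (?T f) (?T g) = laguerre_inner f g" if "f \<in> laguerre_L2" "g \<in> laguerre_L2" for f g
    by (rule bargmann_transform_inner[OF that \<kappa>])
qed

end

theorem proposition3p3:
  shows "(\<forall>z\<in>unit_disk. \<forall>x\<ge>0. set_integrable lborel {0..} (kernel_integrand z x))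
    \<and> (\<forall>f\<in>laguerre_L2. \<forall>z\<in>unit_disk.
          integrable laguerre_measure (\<lambda>x. bargmann_kernel z x * f x)
        \<and> integrable laguerre_measure (\<lambda>x. bargmann_kernel_unit z x * f x))
    \<and> unitary_isomorphism laguerre_L2 laguerre_eq laguerre_inner
        dirichlet_space disk_eq dirichlet_inner_area (bargmann_transform bargmann_kernel)
    \<and> unitary_isomorphism laguerre_L2 laguerre_eq laguerre_inner
        dirichlet_space disk_eq dirichlet_inner (bargmann_transform bargmann_kernel_unit)"
proof (intro conjI ballI allI impI)
  show "set_integrable lborel {0..} (kernel_integrand z x)" if "z \<in> unit_disk" for z x
    using that by (intro kernel_part_sums) simp
  show "integrable laguerre_measure (\<lambda>x. bargmann_kernel z x * f x)"
    "integrable laguerre_measure (\<lambda>x. bargmann_kernel_unit z x * f x)"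
    if "f \<in> laguerre_L2" "z \<in> unit_disk" for f z
    unfolding bargmann_kernel_eq bargmann_kernel_unit_eq
    using that by (auto intro!: bargmann_transform_sums)
  \<comment> \<open>Here \<alpha> = 1/sqrt pi and \<kappa> = pi; the other normalization below has
    \<alpha> = \<kappa> = 1.\<close>
  show "unitary_isomorphism laguerre_L2 laguerre_eq laguerre_inner
      dirichlet_space disk_eq dirichlet_inner_area (bargmann_transform bargmann_kernel)"
    unfolding bargmann_kernel_eq dirichlet_inner_area_eq
    by (intro bargmann_transform_unitary) (simp add: power_divide)
  show "unitary_isomorphism laguerre_L2 laguerre_eq laguerre_inner
      dirichlet_space disk_eq dirichlet_inner (bargmann_transform bargmann_kernel_unit)"
    unfolding bargmann_kernel_unit_eq dirichlet_inner_eq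
    by (intro bargmann_transform_unitary) simp
qed

end
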